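(* Let $(M^n,g)$ be a compact Einstein manifold of even dimension $n$ and let $(N,h)$ be a compact smooth Riemannian manifold. Then every harmonic map from $(M,g)$ to $(N,h)$ is C-harmonic from $(M,[g])$ to $(N,h)$.
   Context: For a map $\psi$, $T\psi$ is the tangent map, a one-form with values in $\psi^*TN$, and $\delta=-\mathrm{div}$ is the formal adjoint of the covariant derivative on $\psi^*TN$ for the indicated source metric; $\varphi$ is harmonic if $\delta^gT\varphi=0$. Definition of C-harmonic maps ($n$ even). A Poincaré metric of $(M,[g])$ is a metric $g_+=r^{-2}(dr^2+g_r)$ on $X=M\times(0,\varepsilon)$ with $g_r=g+g_{(2)}r^2+\cdots+g_{(n-2)}r^{n-2}+\mathcal{O}\,r^n\log r+g_{(n)}r^n+O(r^{n+1})$ (only even powers up to order $n$), where $g_{(2)},\dots,g_{(n-2)},\mathcal{O}$ and $\mathrm{tr}_gg_{(n)}$ are determined by $g$ through the asymptotic Einstein condition $\mathrm{Ric}^{g_+}+n\,g_+=O(r^{n-1}\log r)$. When $g$ is Einstein with $\mathrm{Ric}^g=4\lambda(n-1)g$, one has $g_r=(1-\lambda r^2)^2g$. For a smooth map $\varphi:M\to N$ there is a section $U$ of $(\varphi\circ p_M)^*TN$ near $r=0$ ($p_M$ the projection to $M$), unique modulo $O(r^n)$, such that $\tilde\varphi=\exp_{\varphi\circ p_M}\circ U$ satisfies $\tilde\varphi|_{r=0}=\varphi$ and $\delta^{g_+}T\tilde\varphi=O(r^{n+1}\log r)$; it has an expansion $U=U_2r^2+\cdots+U_{n-2}r^{n-2}+H^g(\varphi)\,r^n\log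 r+U_nr^n+\cdots$. The map $\varphi$ is C-harmonic from $(M,[g])$ to $(N,h)$ if $H^g(\varphi)=0$; this depends only on the conformal class $[g]$. *)

theory Defs
  imports "HOL-Analysis.Analysis"
begin

section \<open>Smooth functions on open subsets of Euclidean spaces\<close>

definition pd :: "('a::real_normed_vector \<Rightarrow> 'b::real_normed_vector) \<Rightarrow> 'a \<Rightarrow> 'a \<Rightarrow> 'b" where
  "pd f v x = frechet_derivative f (at x) v"

primrec Ck_on :: "nat \<Rightarrow> ('a::euclidean_space \<Rightarrow> 'b::real_normed_vector) \<Rightarrow> 'a set \<Rightarrow> bool" where
  "Ck_on 0 f S \<longleftrightarrow> continuous_on S f"
| "Ck_on (Suc k) f S \<longleftrightarrow>
     (\<forall>x\<in>S. f differentiable (at x)) \<and> (\<forall>v\<in>Basis. Ck_on k (pd f v) S)"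

definition smooth_on :: "('a::euclidean_space \<Rightarrow> 'b::real_normed_vector) \<Rightarrow> 'a set \<Rightarrow> bool" where
  "smooth_on f S \<longleftrightarrow> (\<forall>k. Ck_on k f S)"


section \<open>Manifolds, maps and tensors\<close>

text \<open>
  A chart is a pair of a domain and a coordinate map; only the values of the coordinate map on
  the domain matter. The model space \<open>'e\<close> is a Euclidean space, whose dimension
  \<open>DIM('e)\<close> is the dimension of the manifold.
\<close>

type_synonym ('m, 'e) chart = "'m set \<times> ('m \<Rightarrow> 'e)"

definition cinv :: "('m, 'e) chart \<Rightarrow> 'e \<Rightarrow> 'm" where
  "cinv c = inv_into (fst c) (snd c)"

definition crange :: "('m, 'e) chart \<Rightarrow> 'e set" where
  "crange c = snd c ` fst c"

definition smooth_manifold ::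
    "'m::{t2_space,second_countable_topology} set \<Rightarrow> ('m, 'e::euclidean_space) chart set \<Rightarrow> bool" where
  "smooth_manifold S A \<longleftrightarrow>
     (\<Union>c\<in>A. fst c) = S \<and>
     (\<forall>c\<in>A. open (fst c) \<and> open (crange c) \<and> inj_on (snd c) (fst c) \<and>
        continuous_on (fst c) (snd c) \<and> continuous_on (crange c) (cinv c)) \<and>
     (\<forall>c\<in>A. \<forall>c'\<in>A. smooth_on (snd c' \<circ> cinv c) (snd c ` (fst c \<inter> fst c')))"

text \<open>The coordinate representation of a map, and the set on which it is meaningful.\<close>

definition lrep :: "('m, 'e) chart \<Rightarrow> ('q, 'f) chart \<Rightarrow> ('m \<Rightarrow> 'q) \<Rightarrow> 'e \<Rightarrow> 'f" where
  "lrep c d \<phi> = snd d \<circ> \<phi> \<circ> cinv c"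

definition ldom :: "('m, 'e) chart \<Rightarrow> ('q, 'f) chart \<Rightarrow> ('m \<Rightarrow> 'q) \<Rightarrow> 'e set" where
  "ldom c d \<phi> = snd c ` {p \<in> fst c. \<phi> p \<in> fst d}"

definition smooth_map ::
    "('m::topological_space, 'e::euclidean_space) chart set \<Rightarrow>
     ('q::topological_space, 'f::euclidean_space) chart set \<Rightarrow> ('m \<Rightarrow> 'q) \<Rightarrow> bool" where
  "smooth_map A B \<phi> \<longleftrightarrow>
     (\<forall>c\<in>A. continuous_on (fst c) \<phi>) \<and>
     (\<forall>c\<in>A. \<forall>d\<in>B. smooth_on (lrep c d \<phi>) (ldom c d \<phi>))"

text \<open>
  A tangent vector at \<open>q\<close> is the family of its components in all charts around \<open>q\<close>, related by
  the derivatives of the coordinate changes.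
\<close>

definition tangent_vector ::
    "('q, 'f::euclidean_space) chart set \<Rightarrow> 'q \<Rightarrow> (('q, 'f) chart \<Rightarrow> 'f) \<Rightarrow> bool" where
  "tangent_vector B q v \<longleftrightarrow>
     (\<forall>d\<in>B. \<forall>d'\<in>B. q \<in> fst d \<and> q \<in> fst d' \<longrightarrow>
        v d' = frechet_derivative (snd d' \<circ> cinv d) (at (snd d q)) (v d))"

text \<open>Smooth sections of the pull-back bundle \<open>\<psi>\<^sup>*TN\<close>.\<close>

definition section_along ::
    "('m, 'e::euclidean_space) chart set \<Rightarrow> ('q, 'f::euclidean_space) chart set \<Rightarrow>
     ('m \<Rightarrow> 'q) \<Rightarrow> ('m \<Rightarrow> ('q, 'f) chart \<Rightarrow> 'f) \<Rightarrow> bool" where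
  "section_along A B \<psi> V \<longleftrightarrow>
     (\<forall>c\<in>A. \<forall>p\<in>fst c. tangent_vector B (\<psi> p) (V p)) \<and>
     (\<forall>c\<in>A. \<forall>d\<in>B. smooth_on (\<lambda>x. V (cinv c x) d) (ldom c d \<psi>))"

text \<open>
  A covariant 2-tensor field \<open>T\<close> is given by its coordinate expressions: \<open>T c x a b\<close> is the value
  on the vectors with components \<open>a\<close> and \<open>b\<close> in the chart \<open>c\<close>, at the point with
  coordinates \<open>x\<close>.
\<close>

type_synonym ('m, 'e) tensor2 = "('m, 'e) chart \<Rightarrow> 'e \<Rightarrow> 'e \<Rightarrow> 'e \<Rightarrow> real"

definition symmetric_tensor ::
    "('m, 'e::euclidean_space) chart set \<Rightarrow> ('m, 'e) tensor2 \<Rightarrow> bool" where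
  "symmetric_tensor A T \<longleftrightarrow>
     (\<forall>c\<in>A. (\<forall>x\<in>crange c. bilinear (T c x) \<and> (\<forall>a b. T c x a b = T c x b a)) \<and>
        (\<forall>a b. smooth_on (\<lambda>x. T c x a b) (crange c))) \<and>
     (\<forall>c\<in>A. \<forall>c'\<in>A. \<forall>p\<in>fst c \<inter> fst c'. \<forall>a b.
        T c (snd c p) a b =
        T c' (snd c' p) (frechet_derivative (snd c' \<circ> cinv c) (at (snd c p)) a)
                        (frechet_derivative (snd c' \<circ> cinv c) (at (snd c p)) b))"

definition riemannian_metric ::
    "('m, 'e::euclidean_space) chart set \<Rightarrow> ('m, 'e) tensor2 \<Rightarrow> bool" where
  "riemannian_metric A g \<longleftrightarrow>
     symmetric_tensor A g \<and> (\<forall>c\<in>A. \<forall>x\<in>crange c. \<forall>a. a \<noteq> 0 \<longrightarrow> g c x a a > 0)"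


section \<open>Riemannian geometry in coordinates\<close>

text \<open>
  In this section \<open>G\<close> is the coordinate expression of a metric on an open subset of \<open>'e\<close>; the
  indices are the elements of the standard basis of \<open>'e\<close>.
\<close>

type_synonym 'e lmetric = "'e \<Rightarrow> 'e \<Rightarrow> 'e \<Rightarrow> real"

text \<open>The entry \<open>g\<^sup>i\<^sup>j\<close> of the inverse of the matrix \<open>(g\<^sub>i\<^sub>j)\<close>.\<close>

definition inv_metric :: "'e::euclidean_space lmetric \<Rightarrow> 'e lmetric" where
  "inv_metric G x i j = inv (\<lambda>a. \<Sum>b\<in>Basis. G x a b *\<^sub>R b) i \<bullet> j"

text \<open>The symbol \<open>\<Gamma>\<^sup>k\<^sub>i\<^sub>j\<close> is \<open>christoffel G x i j k\<close>.\<close>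

definition christoffel :: "'e::euclidean_space lmetric \<Rightarrow> 'e \<Rightarrow> 'e \<Rightarrow> 'e \<Rightarrow> 'e \<Rightarrow> real" where
  "christoffel G x i j k =
     (\<Sum>l\<in>Basis. inv_metric G x k l *
        (pd (\<lambda>y. G y j l) i x + pd (\<lambda>y. G y i l) j x - pd (\<lambda>y. G y i j) l x)) / 2"

definition christoffel_vec :: "'e::euclidean_space lmetric \<Rightarrow> 'e \<Rightarrow> 'e \<Rightarrow> 'e \<Rightarrow> 'e" where
  "christoffel_vec G x v w =
     (\<Sum>k\<in>Basis. (\<Sum>i\<in>Basis. \<Sum>j\<in>Basis. christoffel G x i j k * (v \<bullet> i) * (w \<bullet> j)) *\<^sub>R k)"

text \<open>\<open>riemann G x i j k l\<close> is the \<open>l\<close>-component of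
  \<open>R(\<partial>\<^sub>i,\<partial>\<^sub>j)\<partial>\<^sub>k = \<nabla>\<^sub>i\<nabla>\<^sub>j\<partial>\<^sub>k - \<nabla>\<^sub>j\<nabla>\<^sub>i\<partial>\<^sub>k\<close>.\<close>

definition riemann :: "'e::euclidean_space lmetric \<Rightarrow> 'e \<Rightarrow> 'e \<Rightarrow> 'e \<Rightarrow> 'e \<Rightarrow> 'e \<Rightarrow> real" where
  "riemann G x i j k l =
     pd (\<lambda>y. christoffel G y j k l) i x - pd (\<lambda>y. christoffel G y i k l) j x
     + (\<Sum>m\<in>Basis. christoffel G x i m l * christoffel G x j k m
                  - christoffel G x j m l * christoffel G x i k m)"

definition ricci :: "'e::euclidean_space lmetric \<Rightarrow> 'e lmetric" where
  "ricci G x j k = (\<Sum>i\<in>Basis. riemann G x i j k i)"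

definition einstein_with ::
    "('m, 'e::euclidean_space) chart set \<Rightarrow> ('m, 'e) tensor2 \<Rightarrow> real \<Rightarrow> bool" where
  "einstein_with A g \<kappa> \<longleftrightarrow>
     (\<forall>c\<in>A. \<forall>x\<in>crange c. \<forall>i\<in>Basis. \<forall>j\<in>Basis. ricci (g c) x i j = \<kappa> * g c x i j)"

definition einstein :: "('m, 'e::euclidean_space) chart set \<Rightarrow> ('m, 'e) tensor2 \<Rightarrow> bool" where
  "einstein A g \<longleftrightarrow> (\<exists>\<kappa>. einstein_with A g \<kappa>)"

text \<open>
  Below, \<open>u\<close> is the coordinate expression of a map \<open>\<psi>\<close> into a manifold with metric \<open>H\<close>, and
  \<open>\<omega> i x\<close> are the components of a one-form with values in \<open>\<psi>\<^sup>*TN\<close>.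
  \<open>nabla\<close> is the \<open>(i,j)\<close>-component of its covariant derivative (\<open>i\<close> the direction of
  differentiation) and \<open>codiff\<close> is \<open>\<delta>\<omega> = -div \<omega>\<close>.
\<close>

definition nabla ::
    "'e::euclidean_space lmetric \<Rightarrow> 'f::euclidean_space lmetric \<Rightarrow> ('e \<Rightarrow> 'f) \<Rightarrow>
     ('e \<Rightarrow> 'e \<Rightarrow> 'f) \<Rightarrow> 'e \<Rightarrow> 'e \<Rightarrow> 'e \<Rightarrow> 'f" where
  "nabla G H u \<omega> x i j =
     pd (\<omega> j) i x - (\<Sum>k\<in>Basis. christoffel G x i j k *\<^sub>R \<omega> k x)
     + christoffel_vec H (u x) (pd u i x) (\<omega> j x)"

definition codiff ::
    "'e::euclidean_space lmetric \<Rightarrow> 'f::euclidean_space lmetric \<Rightarrow> ('e \<Rightarrow> 'f) \<Rightarrow>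
     ('e \<Rightarrow> 'e \<Rightarrow> 'f) \<Rightarrow> 'e \<Rightarrow> 'f" where
  "codiff G H u \<omega> x = - (\<Sum>i\<in>Basis. \<Sum>j\<in>Basis. inv_metric G x i j *\<^sub>R nabla G H u \<omega> x i j)"

text \<open>\<open>\<delta>T\<psi>\<close> in the charts \<open>c\<close> of the source and \<open>d\<close> of the target.\<close>

definition codiff_tangent ::
    "('m, 'e::euclidean_space) tensor2 \<Rightarrow> ('q, 'f::euclidean_space) tensor2 \<Rightarrow>
     ('m, 'e) chart \<Rightarrow> ('q, 'f) chart \<Rightarrow> ('m \<Rightarrow> 'q) \<Rightarrow> 'e \<Rightarrow> 'f" where
  "codiff_tangent g h c d \<psi> = codiff (g c) (h d) (lrep c d \<psi>) (pd (lrep c d \<psi>))"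

definition harmonic_map ::
    "('m::topological_space, 'e::euclidean_space) chart set \<Rightarrow> ('m, 'e) tensor2 \<Rightarrow>
     ('q::topological_space, 'f::euclidean_space) chart set \<Rightarrow> ('q, 'f) tensor2 \<Rightarrow>
     ('m \<Rightarrow> 'q) \<Rightarrow> bool" where
  "harmonic_map A g B h \<phi> \<longleftrightarrow>
     smooth_map A B \<phi> \<and>
     (\<forall>c\<in>A. \<forall>d\<in>B. \<forall>x\<in>ldom c d \<phi>. codiff_tangent g h c d \<phi> x = 0)"

text \<open>
  \<open>is_exp B h q v q'\<close> means \<open>q' = exp\<^sub>q(v)\<close>: there is a geodesic on the unit interval from \<open>q\<close>
  to \<open>q'\<close> with initial velocity \<open>v\<close> (necessarily unique). Here \<open>\<gamma>' t\<close> is the velocity at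
  time \<open>t\<close>.
\<close>

definition is_exp ::
    "('q::topological_space, 'f::euclidean_space) chart set \<Rightarrow> ('q, 'f) tensor2 \<Rightarrow>
     'q \<Rightarrow> (('q, 'f) chart \<Rightarrow> 'f) \<Rightarrow> 'q \<Rightarrow> bool" where
  "is_exp B h q v q' \<longleftrightarrow>
     (\<exists>(\<gamma> :: real \<Rightarrow> 'q) (\<gamma>' :: real \<Rightarrow> ('q, 'f) chart \<Rightarrow> 'f).
        continuous_on {0..1} \<gamma> \<and> \<gamma> 0 = q \<and> \<gamma> 1 = q' \<and>
        (\<forall>d\<in>B. q \<in> fst d \<longrightarrow> \<gamma>' 0 d = v d) \<and>
        (\<forall>t\<in>{0..1}. \<forall>d\<in>B. \<gamma> t \<in> fst d \<longrightarrow>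
           ((\<lambda>s. snd d (\<gamma> s)) has_vector_derivative \<gamma>' t d) (at t within {0..1}) \<and>
           ((\<lambda>s. \<gamma>' s d) has_vector_derivative
              - christoffel_vec (h d) (snd d (\<gamma> t)) (\<gamma>' t d) (\<gamma>' t d)) (at t within {0..1})))"


section \<open>Asymptotics at the boundary\<close>

text \<open>
  \<open>F (x, r) = O(b r)\<close> as \<open>r\<close> tends to 0 from the right, locally uniformly in \<open>x \<in> S\<close>.
\<close>

definition bdry_O ::
    "'e::euclidean_space set \<Rightarrow> (real \<Rightarrow> real) \<Rightarrow> ('e \<times> real \<Rightarrow> 'f::real_normed_vector) \<Rightarrow> bool" where
  "bdry_O S b F \<longleftrightarrow>
     (\<forall>K. compact K \<and> K \<subseteq> S \<longrightarrow>
        (\<exists>C r0. 0 < r0 \<and> (\<forall>x\<in>K. \<forall>r\<in>{0<..<r0}. norm (F (x, r)) \<le> C * \<bar>b r\<bar>)))"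

text \<open>
  Remainders of asymptotic expansions: the estimate may be differentiated, where \<open>\<partial>\<^sub>x\<close> and
  \<open>r \<partial>\<^sub>r\<close> preserve the order in \<open>r\<close>.
\<close>

primrec bdry_O_k ::
    "nat \<Rightarrow> 'e::euclidean_space set \<Rightarrow> (real \<Rightarrow> real) \<Rightarrow> ('e \<times> real \<Rightarrow> 'f::real_normed_vector) \<Rightarrow> bool" where
  "bdry_O_k 0 S b F \<longleftrightarrow> bdry_O S b F"
| "bdry_O_k (Suc k) S b F \<longleftrightarrow>
     bdry_O S b F \<and>
     (\<forall>a\<in>Basis. bdry_O_k k S b (pd F (a, 0))) \<and>
     bdry_O_k k S b (\<lambda>z. snd z *\<^sub>R pd F (0, 1) z)"

definition bdry_O_smooth ::
    "'e::euclidean_space set \<Rightarrow> (real \<Rightarrow> real) \<Rightarrow> ('e \<times> real \<Rightarrow> 'f::real_normed_vector) \<Rightarrow> bool" where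
  "bdry_O_smooth S b F \<longleftrightarrow> (\<forall>k. bdry_O_k k S b F)"


section \<open>Poincare metrics and C-harmonic maps\<close>

text \<open>The product chart on the cylinder \<open>M \<times> (0,\<epsilon>)\<close>.\<close>

definition cyl :: "real \<Rightarrow> ('m, 'e) chart \<Rightarrow> ('m \<times> real, 'e \<times> real) chart" where
  "cyl \<epsilon> c = (fst c \<times> {0<..<\<epsilon>}, \<lambda>(p, r). (snd c p, r))"

text \<open>
  Poincare metrics \<open>G = r\<^sup>-\<^sup>2 (dr\<^sup>2 + g\<^sub>r)\<close> in normal form with respect to the representative \<open>g\<close>
  of the conformal class, for \<open>n = DIM('e)\<close> even. The coefficient \<open>g\<^sub>(\<^sub>k\<^sub>)\<close> is \<open>gk k\<close>, and
  \<open>Obs\<close> is the coefficient of \<open>r\<^sup>n log r\<close>.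
\<close>

definition poincare_metric ::
    "('m, 'e::euclidean_space) chart set \<Rightarrow> ('m, 'e) tensor2 \<Rightarrow> real \<Rightarrow>
     ('m \<times> real, 'e \<times> real) tensor2 \<Rightarrow> bool" where
  "poincare_metric A g \<epsilon> G \<longleftrightarrow>
     0 < \<epsilon> \<and> riemannian_metric (cyl \<epsilon> ` A) G \<and>
     (\<exists>(gr :: real \<Rightarrow> ('m, 'e) tensor2) (gk :: nat \<Rightarrow> ('m, 'e) tensor2) (Obs :: ('m, 'e) tensor2).
        (\<forall>c\<in>A. \<forall>x\<in>crange c. \<forall>r\<in>{0<..<\<epsilon>}. \<forall>a b s t.
           G (cyl \<epsilon> c) (x, r) (a, s) (b, t) = (s * t + gr r c x a b) / r\<^sup>2) \<and>
        (\<forall>k. symmetric_tensor A (gk k)) \<and> symmetric_tensor A Obs \<and>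
        (\<forall>c\<in>A. \<forall>a\<in>Basis. \<forall>b\<in>Basis.
           bdry_O_smooth (crange c) (\<lambda>r. r ^ (DIM('e) + 1))
             (\<lambda>(x, r). gr r c x a b
                - (g c x a b + (\<Sum>k | 2 \<le> k \<and> k \<le> DIM('e) \<and> even k. r ^ k * gk k c x a b)
                   + r ^ DIM('e) * ln r * Obs c x a b)))) \<and>
     (\<forall>c\<in>A. \<forall>i\<in>Basis. \<forall>j\<in>Basis.
        bdry_O (crange c) (\<lambda>r. r ^ (DIM('e) - 1) * ln r)
          (\<lambda>z. ricci (G (cyl \<epsilon> c)) z i j + real DIM('e) * G (cyl \<epsilon> c) z i j))"

text \<open>
  \<open>approx_harmonic_extension A g B h \<phi> \<epsilon> G U \<psi> H\<close>: the map \<open>\<psi> = exp\<^bsub>\<phi> \<circ> p\<^esub> \<circ> U\<close> on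
  \<open>M \<times> (0,\<epsilon>)\<close> extends \<open>\<phi>\<close>, is harmonic for \<open>G\<close> up to \<open>O(r\<^sup>n\<^sup>+\<^sup>1 log r)\<close>, and \<open>H\<close> is the
  coefficient of \<open>r\<^sup>n log r\<close> in the expansion of \<open>U\<close>. The values of \<open>\<psi>\<close> at \<open>r = 0\<close> are the
  boundary values.
\<close>

definition approx_harmonic_extension ::
    "('m::topological_space, 'e::euclidean_space) chart set \<Rightarrow>
     ('q::topological_space, 'f::euclidean_space) chart set \<Rightarrow> ('q, 'f) tensor2 \<Rightarrow> ('m \<Rightarrow> 'q) \<Rightarrow>
     real \<Rightarrow> ('m \<times> real, 'e \<times> real) tensor2 \<Rightarrow>
     ('m \<times> real \<Rightarrow> ('q, 'f) chart \<Rightarrow> 'f) \<Rightarrow> ('m \<times> real \<Rightarrow> 'q) \<Rightarrow>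
     ('m \<Rightarrow> ('q, 'f) chart \<Rightarrow> 'f) \<Rightarrow> bool" where
  "approx_harmonic_extension A B h \<phi> \<epsilon> G U \<psi> H \<longleftrightarrow>
     section_along (cyl \<epsilon> ` A) B (\<phi> \<circ> fst) U \<and>
     smooth_map (cyl \<epsilon> ` A) B \<psi> \<and>
     (\<forall>p. \<forall>r\<in>{0<..<\<epsilon>}. is_exp B h (\<phi> p) (U (p, r)) (\<psi> (p, r))) \<and>
     continuous_on (UNIV \<times> {0..<\<epsilon>}) \<psi> \<and> (\<forall>p. \<psi> (p, 0) = \<phi> p) \<and>
     (\<forall>c\<in>A. \<forall>d\<in>B.
        bdry_O (ldom c d \<phi>) (\<lambda>r. r ^ (DIM('e) + 1) * ln r)
          (codiff_tangent G h (cyl \<epsilon> c) d \<psi>)) \<and>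
     section_along A B \<phi> H \<and>
     (\<exists>Uk :: nat \<Rightarrow> 'm \<Rightarrow> ('q, 'f) chart \<Rightarrow> 'f.
        (\<forall>k. section_along A B \<phi> (Uk k)) \<and>
        (\<forall>c\<in>A. \<forall>d\<in>B.
           bdry_O_smooth (ldom c d \<phi>) (\<lambda>r. r ^ (DIM('e) + 1) * ln r)
             (\<lambda>(x, r). U (cinv c x, r) d
                - ((\<Sum>k | 2 \<le> k \<and> k \<le> DIM('e) \<and> even k. r ^ k *\<^sub>R Uk k (cinv c x) d)
                   + (r ^ DIM('e) * ln r) *\<^sub>R H (cinv c x) d))))"

text \<open>
  \<open>is_log_coefficient A g B h \<phi> H\<close> means \<open>H = H\<^sup>g(\<phi>)\<close>. Since the extension is unique modulo
  \<open>O(r\<^sup>n)\<close> and the relevant part of the Poincare metric is determined by \<open>g\<close>, the section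
  \<open>H\<close> does not depend on the choices made here.
\<close>

definition is_log_coefficient ::
    "('m::topological_space, 'e::euclidean_space) chart set \<Rightarrow> ('m, 'e) tensor2 \<Rightarrow>
     ('q::topological_space, 'f::euclidean_space) chart set \<Rightarrow> ('q, 'f) tensor2 \<Rightarrow> ('m \<Rightarrow> 'q) \<Rightarrow>
     ('m \<Rightarrow> ('q, 'f) chart \<Rightarrow> 'f) \<Rightarrow> bool" where
  "is_log_coefficient A g B h \<phi> H \<longleftrightarrow>
     (\<exists>\<epsilon> G U \<psi>. poincare_metric A g \<epsilon> G \<and> approx_harmonic_extension A B h \<phi> \<epsilon> G U \<psi> H)"

definition C_harmonic_map ::
    "('m::topological_space, 'e::euclidean_space) chart set \<Rightarrow> ('m, 'e) tensor2 \<Rightarrow>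
     ('q::topological_space, 'f::euclidean_space) chart set \<Rightarrow> ('q, 'f) tensor2 \<Rightarrow> ('m \<Rightarrow> 'q) \<Rightarrow> bool" where
  "C_harmonic_map A g B h \<phi> \<longleftrightarrow>
     smooth_map A B \<phi> \<and>
     (\<exists>H. is_log_coefficient A g B h \<phi> H \<and> (\<forall>p. \<forall>d\<in>B. \<phi> p \<in> fst d \<longrightarrow> H p d = 0))"

end

theory Submission
  imports Defs
begin

text \<open>
  If \<open>Ric = 4 \<lambda> (n - 1) g\<close>, then \<open>G = r\<^sup>-\<^sup>2 (dr\<^sup>2 + (1 - \<lambda> r\<^sup>2)\<^sup>2 g)\<close> is an exact Einstein metric near
  \<open>r = 0\<close>, hence a Poincare metric without logarithmic term. For a map that does not depend on \<open>r\<close>,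
  the \<open>r\<close>-derivatives and the mixed and normal Christoffel symbols drop out of \<open>\<delta>T\<close>, which becomes
  \<open>r\<^sup>2 (1 - \<lambda> r\<^sup>2)\<^sup>-\<^sup>2 \<delta>\<^sup>gT\<phi>\<close>. So for harmonic \<open>\<phi>\<close> the constant extension, \<open>U = 0\<close>, is exactly
  harmonic, and its coefficient of \<open>r\<^sup>n log r\<close> vanishes.
\<close>

section \<open>Partial derivatives and smooth functions\<close>

text \<open>In the unit-speed parameter t = ln r the metric G is the warped product dt^2 + q^2 g
  with q = 1/r - \<lambda> r. With a prime for r d/dr, this q satisfies q'' = q and q'^2 - q^2 = 4
  \<lambda>, and these two identities turn Ric = 4 \<lambda> (n - 1) g into Ric = -n G. The
  curvature is therefore computed for arbitrary q and specialised afterwards. The obstacle is the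
  coordinate form of the definitions. \<open>frechet_derivative\<close> carries no information where
  no derivative exists, and the inverse metric is \<open>inv\<close> of a linear map, so
  differentiability of the inverse metric and of the Christoffel symbols has to be established
  before a curvature term can be evaluated. Moreover, coordinate formulas hold only over chart
  ranges, so two expressions are identified on an open set before they are differentiated. The
  calculation stays short because every Christoffel symbol of the warped metric is a function of x
  times a function of r.\<close>

lemma pd_eqI: "(f has_derivative f') (at x) \<Longrightarrow> pd f v x = f' v"
  unfolding pd_def by (simp add: frechet_derivative_at[symmetric])

lemma pd_has_derivative: "f differentiable (at x) \<Longrightarrow> (f has_derivative (\<lambda>v. pd f v x)) (at x)"
  unfolding pd_def using frechet_derivative_works by blast

text \<open>\<open>frechet_derivative\<close> chooses among all derivatives at the point, and both
  maps have the same ones; hence the equation also holds where there is none.\<close>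

lemma pd_cong:
  assumes "open S" "x \<in> S" "\<And>y. y \<in> S \<Longrightarrow> f y = g y"
  shows "pd f v x = pd g v x"
proof -
  have "(f has_derivative D) (at x) \<longleftrightarrow> (g has_derivative D) (at x)" for D
    using has_derivative_transform_within_open[of f D x UNIV S g]
      has_derivative_transform_within_open[of g D x UNIV S f] assms by auto
  then show ?thesis
    by (simp add: pd_def frechet_derivative_def)
qed

lemma differentiable_cong:
  assumes "open S" "x \<in> S" "\<And>y. y \<in> S \<Longrightarrow> f y = g y"
  shows "f differentiable (at x) \<longleftrightarrow> g differentiable (at x)"
  using has_derivative_transform_within_open[of f _ x UNIV S g]
      has_derivative_transform_within_open[of g _ x UNIV S f] assms
  unfolding differentiable_def by metis

lemma Ck_on_cong:
  assumes "open S" "\<And>y. y \<in> S \<Longrightarrow> f y = g y"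
  shows "Ck_on k f S \<longleftrightarrow> Ck_on k g S"
  using assms(2)
proof (induction k arbitrary: f g)
  case 0
  then show ?case by (simp cong: continuous_on_cong)
next
  case (Suc k)
  have "Ck_on k (pd f v) S \<longleftrightarrow> Ck_on k (pd g v) S" for v
    by (rule Suc.IH) (metis Suc.prems assms(1) pd_cong)
  then show ?case
    using differentiable_cong[OF assms(1) _ Suc.prems] by auto
qed

lemma smooth_on_cong:
  assumes "open S" "\<And>y. y \<in> S \<Longrightarrow> f y = g y"
  shows "smooth_on f S \<longleftrightarrow> smooth_on g S"
  unfolding smooth_on_def using Ck_on_cong[OF assms] by simp

lemma Ck_on_Suc_imp: "Ck_on (Suc k) f S \<Longrightarrow> Ck_on k f S"
proof (induction k arbitrary: f)
  case 0
  then show ?case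
    by (auto intro!: differentiable_imp_continuous_on differentiable_at_imp_differentiable_on)
qed auto

lemma Ck_on_const: "Ck_on k (\<lambda>_. c) S"
proof (induction k arbitrary: c)
  case (Suc k)
  have "pd (\<lambda>_::'a. c) v = (\<lambda>_. 0)" for v
    by (rule ext, rule pd_eqI) simp
  then show ?case using Suc by simp
qed simp

lemma Ck_on_add:
  assumes "open S"
  shows "Ck_on k f S \<Longrightarrow> Ck_on k g S \<Longrightarrow> Ck_on k (\<lambda>x. f x + g x) S"
proof (induction k arbitrary: f g)
  case 0
  then show ?case by (simp add: continuous_on_add)
next
  case (Suc k)
  have "Ck_on k (pd (\<lambda>x. f x + g x) v) S" if "v \<in> Basis" for v
  proof -
    have "Ck_on k (pd (\<lambda>x. f x + g x) v) S \<longleftrightarrow> Ck_on k (\<lambda>x. pd f v x + pd g v x) S"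
      by (rule Ck_on_cong[OF assms], rule pd_eqI)
        (use Suc.prems in \<open>auto intro!: derivative_intros pd_has_derivative\<close>)
    then show ?thesis using Suc that by simp
  qed
  then show ?case using Suc.prems by simp
qed

lemma Ck_on_mult:
  fixes f g :: "'a::euclidean_space \<Rightarrow> real"
  assumes "open S"
  shows "Ck_on k f S \<Longrightarrow> Ck_on k g S \<Longrightarrow> Ck_on k (\<lambda>x. f x * g x) S"
proof (induction k arbitrary: f g)
  case 0
  then show ?case by (simp add: continuous_on_mult)
next
  case (Suc k)
  have "Ck_on k (pd (\<lambda>x. f x * g x) v) S" if "v \<in> Basis" for v
  proof -
    have "Ck_on k (pd (\<lambda>x. f x * g x) v) S
        \<longleftrightarrow> Ck_on k (\<lambda>x. f x * pd g v x + pd f v x * g x) S"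
      by (rule Ck_on_cong[OF assms], rule pd_eqI)
        (use Suc.prems in \<open>auto intro!: derivative_intros pd_has_derivative\<close>)
    moreover have "Ck_on k f S" "Ck_on k g S"
      using Suc.prems Ck_on_Suc_imp by blast+
    ultimately show ?thesis
      using Suc that assms by (auto intro!: Ck_on_add)
  qed
  then show ?case using Suc.prems by simp
qed

lemma smooth_on_const: "smooth_on (\<lambda>_. c) S"
  by (simp add: smooth_on_def Ck_on_const)

lemma smooth_on_add: "open S \<Longrightarrow> smooth_on f S \<Longrightarrow> smooth_on g S \<Longrightarrow> smooth_on (\<lambda>x. f x + g x) S"
  by (simp add: smooth_on_def Ck_on_add)

lemma smooth_on_mult:
  fixes f g :: "'a::euclidean_space \<Rightarrow> real"
  shows "open S \<Longrightarrow> smooth_on f S \<Longrightarrow> smooth_on g S \<Longrightarrow> smooth_on (\<lambda>x. f x * g x) S"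
  by (simp add: smooth_on_def Ck_on_mult)

lemma smooth_on_continuous_on: "smooth_on f S \<Longrightarrow> continuous_on S f"
  unfolding smooth_on_def by (metis Ck_on.simps(1))

lemma smooth_on_differentiable: "smooth_on f S \<Longrightarrow> x \<in> S \<Longrightarrow> f differentiable (at x)"
  unfolding smooth_on_def by (metis Ck_on.simps(2))

lemma smooth_on_pd: "smooth_on f S \<Longrightarrow> v \<in> Basis \<Longrightarrow> smooth_on (pd f v) S"
  unfolding smooth_on_def by (metis Ck_on.simps(2))

lemma smooth_on_subset: "smooth_on f S \<Longrightarrow> T \<subseteq> S \<Longrightarrow> smooth_on f T"
proof -
  have "Ck_on k f S \<Longrightarrow> T \<subseteq> S \<Longrightarrow> Ck_on k f T" for k
    by (induction k arbitrary: f) (auto intro: continuous_on_subset)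
  then show "smooth_on f S \<Longrightarrow> T \<subseteq> S \<Longrightarrow> smooth_on f T"
    by (simp add: smooth_on_def)
qed

section \<open>Functions pulled back to the cylinder, and negative powers of r\<close>

lemma pd_comp_fst:
  fixes f :: "'a::real_normed_vector \<Rightarrow> 'b::real_normed_vector" and z :: "'a \<times> real"
  assumes "f differentiable (at (fst z))"
  shows "pd (\<lambda>z. f (fst z)) v z = pd f (fst v) (fst z)"
proof -
  have "((\<lambda>z. f (fst z)) has_derivative (\<lambda>v. pd f (fst v) (fst z))) (at z)"
    by (rule has_derivative_compose[OF has_derivative_fst[OF has_derivative_ident]])
      (rule pd_has_derivative[OF assms])
  then show ?thesis by (rule pd_eqI)
qed

lemma differentiable_comp_fst:
  fixes f :: "'a::real_normed_vector \<Rightarrow> 'b::real_normed_vector" and z :: "'a \<times> real"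
  assumes "f differentiable (at (fst z))"
  shows "(\<lambda>z. f (fst z)) differentiable (at z)"
  using has_derivative_compose[OF has_derivative_fst[OF has_derivative_ident]
      pd_has_derivative[OF assms]] differentiable_def by blast

lemma smooth_on_comp_fst:
  fixes f :: "'a::euclidean_space \<Rightarrow> 'b::real_normed_vector"
  assumes "open S" "smooth_on f S"
  shows "smooth_on (\<lambda>z::'a \<times> real. f (fst z)) (S \<times> UNIV)"
proof -
  have "Ck_on k f S \<Longrightarrow> Ck_on k (\<lambda>z::'a \<times> real. f (fst z)) (S \<times> UNIV)" for k
  proof (induction k arbitrary: f)
    case 0
    then show ?case
      by (auto intro!: continuous_on_compose2[of S f] continuous_intros)
  next
    case (Suc k)
    have "Ck_on k (pd (\<lambda>z::'a \<times> real. f (fst z)) v) (S \<times> UNIV)" if "v \<in> Basis" for v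
    proof -
      have "Ck_on k (pd (\<lambda>z::'a \<times> real. f (fst z)) v) (S \<times> UNIV)
          \<longleftrightarrow> Ck_on k (\<lambda>z. pd f (fst v) (fst z)) (S \<times> (UNIV::real set))"
        by (rule Ck_on_cong) (use Suc.prems assms(1) in \<open>auto intro!: open_Times pd_comp_fst\<close>)
      also have "\<dots>"
      \<comment> \<open>A basis vector of the product is (i, 0) or (0, 1). For the latter the
        induction hypothesis says nothing, but the derivative is zero.\<close>
      proof (cases "fst v = 0")
        case True
        have "Ck_on k (\<lambda>z. pd f 0 (fst z)) (S \<times> (UNIV::real set))
          \<longleftrightarrow> Ck_on k (\<lambda>z. 0::'b) (S \<times> (UNIV::real set))"
        proof (rule Ck_on_cong)
          fix z :: "'a \<times> real" assume "z \<in> S \<times> UNIV"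
          then have "f differentiable (at (fst z))"
            using Suc.prems by auto
          then have "linear (\<lambda>v. pd f v (fst z))"
            by (rule has_derivative_linear[OF pd_has_derivative])
          then show "pd f 0 (fst z) = 0" by (rule linear_0)
        qed (use assms in \<open>auto intro!: open_Times\<close>)
        then show ?thesis using True by (simp add: Ck_on_const)
      next
        case False
        then have "fst v \<in> Basis" using that by (auto simp: Basis_prod_def)
        then show ?thesis using Suc by auto
      qed
      finally show ?thesis .
    qed
    then show ?case using Suc.prems by (auto intro!: differentiable_comp_fst)
  qed
  then show ?thesis using assms(2) by (simp add: smooth_on_def)
qed

lemma smooth_on_snd: "smooth_on (\<lambda>z::'a::euclidean_space \<times> real. snd z) S"
proof -
  have 1: "(snd has_derivative snd) (at z)" for z :: "'a \<times> real"
    by (rule has_derivative_snd[OF has_derivative_ident])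
  have "pd snd v = (\<lambda>z::'a \<times> real. snd v)" for v
    by (rule ext, rule pd_eqI, rule 1)
  then have "Ck_on k (\<lambda>z::'a \<times> real. snd z) S" for k
    using 1 by (cases k) (auto simp: Ck_on_const differentiable_def intro!: continuous_intros exI[of _ snd])
  then show ?thesis by (simp add: smooth_on_def)
qed

text \<open>All exponents are treated together: differentiating one power gives a multiple of the
  next, so the induction on the order of differentiability needs m arbitrary.\<close>

lemma smooth_on_inverse_snd_power:
  "smooth_on (\<lambda>z::'a::euclidean_space \<times> real. inverse (snd z) ^ m) (UNIV \<times> {0<..})"
proof -
  let ?T = "UNIV \<times> {0<..} :: ('a \<times> real) set"
  have op: "open ?T" by (intro open_Times) auto
  have 1: "((\<lambda>z. inverse (snd z) ^ m) has_derivative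
      (\<lambda>v. (- real m * snd v) * inverse (snd z) ^ (m + 1))) (at z)"
    if "z \<in> ?T" for z :: "'a \<times> real" and m
  proof -
    have "snd z \<noteq> 0" using that by auto
    then have "((\<lambda>r. inverse r ^ m) has_real_derivative - real m * inverse (snd z) ^ (m + 1))
        (at (snd z))"
      using DERIV_power[OF DERIV_inverse, of "snd z" m UNIV]
      by (cases m) (simp_all add: algebra_simps)
    from DERIV_compose_FDERIV[OF this has_derivative_snd[OF has_derivative_ident]]
    show ?thesis by (simp add: algebra_simps)
  qed
  have "Ck_on k (\<lambda>z::'a \<times> real. inverse (snd z) ^ m) ?T" for k
  proof (induction k arbitrary: m)
    case 0
    show ?case by (auto intro!: continuous_intros)
  next
    case (Suc k)
    have "Ck_on k (pd (\<lambda>z. inverse (snd z) ^ m) v) ?T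
        \<longleftrightarrow> Ck_on k (\<lambda>z. (- real m * snd v) * inverse (snd z) ^ (m + 1)) ?T" for v
      by (rule Ck_on_cong[OF op], rule pd_eqI, rule 1)
    moreover have "Ck_on k (\<lambda>z. (- real m * snd v) * inverse (snd z) ^ (m + 1)) ?T" for v :: "'a \<times> real"
      by (intro Ck_on_mult op Ck_on_const Suc.IH)
    moreover have "(\<lambda>z. inverse (snd z) ^ m) differentiable (at z)" if "z \<in> ?T" for z
      using 1[OF that] unfolding differentiable_def by blast
    ultimately show ?case by (simp only: Ck_on.simps) blast
  qed
  then show ?thesis by (simp add: smooth_on_def)
qed

section \<open>The inverse metric\<close>

lemma sum_Basis_prod:
  fixes f :: "'a::euclidean_space \<times> real \<Rightarrow> 'c::comm_monoid_add"
  shows "sum f Basis = (\<Sum>i\<in>Basis. f (i, 0)) + f (0, 1)"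
proof -
  have "inj_on (\<lambda>u. (u::'a, 0::real)) Basis"
    by (auto intro!: inj_onI)
  moreover have "(\<lambda>u. (u::'a, 0::real)) ` Basis \<inter> {(0,1)} = {}"
    by auto
  ultimately show ?thesis
    unfolding Basis_prod_def
    by (subst sum.union_disjoint) (auto simp: sum.reindex)
qed

lemma bilinear_sum_Basis:
  fixes T :: "'e::euclidean_space \<Rightarrow> 'e \<Rightarrow> real"
  assumes "bilinear T"
  shows "(\<Sum>l\<in>Basis. (v \<bullet> l) * T a l) = T a v"
proof -
  have "linear (T a)" using assms by (simp add: bilinear_def)
  then have "T a (\<Sum>l\<in>Basis. (v \<bullet> l) *\<^sub>R l) = (\<Sum>l\<in>Basis. (v \<bullet> l) * T a l)"
    by (simp add: linear_sum linear_scale)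
  then show ?thesis by (simp add: euclidean_representation)
qed

text \<open>What a Riemannian metric provides on the range of a single chart; all curvature
  calculations take place here, without a manifold.\<close>

locale local_metric =
  fixes S :: "'e::euclidean_space set" and g :: "'e lmetric"
  assumes open_S: "open S"
    and bilin: "x \<in> S \<Longrightarrow> bilinear (g x)"
    and symm: "x \<in> S \<Longrightarrow> g x a b = g x b a"
    and pos: "x \<in> S \<Longrightarrow> a \<noteq> 0 \<Longrightarrow> 0 < g x a a"
    and smooth: "smooth_on (\<lambda>x. g x a b) S"
begin

text \<open>Lowering an index, with covectors identified with vectors by the Euclidean inner
  product; \<open>inv_metric\<close> inverts exactly this map.\<close>

definition lower :: "'e \<Rightarrow> 'e \<Rightarrow> 'e" where
  "lower x a = (\<Sum>b\<in>Basis. g x a b *\<^sub>R b)"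

definition raise :: "'e \<Rightarrow> 'e \<Rightarrow> 'e" where
  "raise x = inv (lower x)"

lemma inv_metric_raise: "inv_metric g x i j = raise x i \<bullet> j"
  by (simp add: inv_metric_def raise_def lower_def[abs_def])

lemma lower_inner: "x \<in> S \<Longrightarrow> lower x a \<bullet> v = g x a v"
  using bilinear_sum_Basis[OF bilin, of x v a]
  by (simp add: lower_def inner_sum_left inner_sum_right inner_commute[of _ v] mult.commute)

lemma linear_lower: "x \<in> S \<Longrightarrow> linear (lower x)"
  using bilin[of x] unfolding lower_def bilinear_def
  by (intro linearI) (auto simp: linear_add[of "\<lambda>a. g x a _"] linear_scale[of "\<lambda>a. g x a _"]
      scaleR_left_distrib sum.distrib scaleR_sum_right)

text \<open>The inner product of \<open>lower x a\<close> with a is the squared length of a, so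
  positivity excludes a kernel.\<close>

lemma inj_lower:
  assumes "x \<in> S" shows "inj (lower x)"
proof -
  have "a = 0" if "lower x a = 0" for a
    using lower_inner[OF assms, of a a] pos[OF assms, of a] that by fastforce
  then show ?thesis
    using linear_injective_0[OF linear_lower[OF assms]] by blast
qed

lemma bij_lower: "x \<in> S \<Longrightarrow> bij (lower x)"
  using inj_lower linear_lower linear_injective_imp_surjective[of "lower x"] by (simp add: bij_def)

lemma lower_raise: "x \<in> S \<Longrightarrow> lower x (raise x v) = v"
  unfolding raise_def using bij_lower by (simp add: bij_is_surj surj_f_inv_f)

lemma raise_lower: "x \<in> S \<Longrightarrow> raise x (lower x v) = v"
  unfolding raise_def using inj_lower by (simp add: inv_f_f)

lemma raise_eqI: "x \<in> S \<Longrightarrow> lower x v = w \<Longrightarrow> raise x w = v"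
  using raise_lower by blast

lemma metric_raise: "x \<in> S \<Longrightarrow> g x (raise x v) w = v \<bullet> w"
  using lower_inner[of x "raise x v" w] lower_raise by simp

lemma inv_metric_contract:
  assumes "x \<in> S"
  shows "(\<Sum>l\<in>Basis. inv_metric g x k l * g x i l) = k \<bullet> i"
  unfolding inv_metric_raise bilinear_sum_Basis[OF bilin[OF assms]]
  using symm[OF assms] metric_raise[OF assms] by metis

text \<open>The inverse metric is differentiable because \<open>(y, v) \<mapsto> (y, lower y v)\<close> is
  invertible near \<open>x\<close> with invertible derivative; this avoids determinants.\<close>

lemma differentiable_raise:
  assumes x: "x \<in> S"
  shows "(\<lambda>y. raise y w) differentiable (at x)"
proof -
  define f where "f = (\<lambda>z::'e \<times> 'e. (fst z, lower (fst z) (snd z)))"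
  define k where "k = (\<lambda>z::'e \<times> 'e. (fst z, raise (fst z) (snd z)))"
  let ?v = "raise x w"
  define f' where "f' = (\<lambda>d::'e \<times> 'e. (fst d,
     (\<Sum>b\<in>Basis. (\<Sum>a\<in>Basis. g x a b * (snd d \<bullet> a) + pd (\<lambda>y. g y a b) (fst d) x * (?v \<bullet> a)) *\<^sub>R b)))"
  \<comment> \<open>In matrix form each summand is a function of y times a linear function of v, so
    the product rule gives the derivative \<open>f'\<close>.\<close>
  have lower_eq: "lower y v = (\<Sum>b\<in>Basis. (\<Sum>a\<in>Basis. g y a b * (v \<bullet> a)) *\<^sub>R b)" if "y \<in> S" for y v
  proof -
    have "g y v b = (\<Sum>a\<in>Basis. g y a b * (v \<bullet> a))" for b
      using bilinear_sum_Basis[OF bilin[OF that], of v b] symm[OF that]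
      by (simp add: mult.commute cong: sum.cong)
    then show ?thesis by (simp add: lower_def)
  qed
  let ?f = "\<lambda>z. (fst z, \<Sum>b\<in>Basis. (\<Sum>a\<in>Basis. g (fst z) a b * (snd z \<bullet> a)) *\<^sub>R b)"
  have f_eq: "f z = ?f z" if "z \<in> S \<times> UNIV" for z
    using that lower_eq by (auto simp: f_def)
  have op: "open (S \<times> (UNIV :: 'e set))" using open_S by (intro open_Times) auto
  have cont_g: "continuous_on (S \<times> UNIV) (\<lambda>z::'e\<times>'e. g (fst z) a b)" for a b
    using smooth_on_continuous_on[OF smooth]
    by (rule continuous_on_compose2[OF _ continuous_on_fst[OF continuous_on_id]]) auto
  have "continuous_on (S \<times> UNIV) ?f"
    by (intro continuous_intros cont_g)
  then have cont: "continuous_on (S \<times> UNIV) f"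
    by (subst continuous_on_cong[OF refl f_eq])
  have der_g: "((\<lambda>z::'e\<times>'e. g (fst z) a b) has_derivative (\<lambda>d. pd (\<lambda>y. g y a b) (fst d) x)) (at (x, ?v))" for a b
  proof -
    have "((\<lambda>y. g y a b) has_derivative (\<lambda>d. pd (\<lambda>y. g y a b) d x)) (at (fst (x, ?v)))"
      using pd_has_derivative[OF smooth_on_differentiable[OF smooth x]] by simp
    from has_derivative_compose[OF has_derivative_fst[OF has_derivative_ident] this]
    show ?thesis by simp
  qed
  have "(?f has_derivative f') (at (x, ?v))"
    unfolding f'_def
    by (auto intro!: derivative_eq_intros der_g simp: algebra_simps)
  then have der: "(f has_derivative f') (at (x, ?v))"
    by (rule has_derivative_transform_within_open[OF _ op]) (use x f_eq in auto)
  have "linear f'" using der by (rule has_derivative_linear)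
  \<comment> \<open>The derivative is block triangular: its first component forces
    \<open>fst d = 0\<close>, and what then remains of the second is
    \<open>lower x (snd d)\<close>.\<close>
  moreover have "d = 0" if "f' d = 0" for d
  proof -
    have 1: "fst d = 0" and 2: "snd (f' d) = 0" using that by (auto simp: f'_def zero_prod_def)
    have "pd (\<lambda>y. g y a b) 0 x = 0" for a b
      using pd_has_derivative[OF smooth_on_differentiable[OF smooth x]] has_derivative_linear linear_0 by blast
    then have "lower x (snd d) = 0"
      using 1 2 by (simp add: f'_def lower_eq[OF x])
    then have "snd d = 0"
      using raise_lower[OF x] linear_lower[OF x] linear_0 by metis
    then show ?thesis using 1 by (simp add: prod_eq_iff)
  qed
  ultimately have "inj f'" using linear_injective_0 by blast
  then obtain g' where "linear g'" and "\<forall>x. g' (f' x) = x" "\<forall>x. f' (g' x) = x"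
    using linear_injective_isomorphism[OF \<open>linear f'\<close>] by blast
  then have "(k has_derivative g') (at (f (x, ?v)))"
    by (intro has_derivative_inverse_strong[OF op _ cont _ der])
      (use x in \<open>auto simp: k_def f_def raise_lower fun_eq_iff\<close>)
  then have k: "(k has_derivative g') (at ((\<lambda>y. (y, w)) x))"
    using lower_raise[OF x] by (simp add: f_def)
  \<comment> \<open>Restricting the inverse map \<open>k\<close> to the slice with second entry w
    recovers \<open>raise y w\<close>.\<close>
  have "((\<lambda>y. k (y, w)) has_derivative (\<lambda>d. g' (d, 0))) (at x)"
    by (rule has_derivative_compose[where f = "\<lambda>y. (y, w)" and g = k and g' = g'])
      (auto intro!: derivative_eq_intros k[simplified])
  then have "((\<lambda>y. snd (k (y, w))) has_derivative (\<lambda>d. snd (g' (d, 0)))) (at x)"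
    by (rule has_derivative_snd)
  then show ?thesis
    unfolding differentiable_def k_def by auto
qed

lemma differentiable_inv_metric: "x \<in> S \<Longrightarrow> (\<lambda>y. inv_metric g y i j) differentiable (at x)"
  unfolding inv_metric_raise using differentiable_raise
  by (auto intro!: derivative_intros)

lemma differentiable_christoffel:
  assumes "x \<in> S" "i \<in> Basis" "j \<in> Basis"
  shows "(\<lambda>y. christoffel g y i j k) differentiable (at x)"
proof -
  have "pd (\<lambda>y. g y a b) c differentiable (at x)" if "c \<in> Basis" for a b c
    using smooth_on_differentiable[OF smooth_on_pd[OF smooth that] assms(1)] .
  then show ?thesis
    unfolding christoffel_def using assms
    by (auto intro!: derivative_intros differentiable_inv_metric)
qed

lemma christoffel_sym:
  assumes "x \<in> S"
  shows "christoffel g x i j k = christoffel g x j i k"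
proof -
  have "pd (\<lambda>y. g y i j) l x = pd (\<lambda>y. g y j i) l x" for l
    by (rule pd_cong[OF open_S assms symm])
  then show ?thesis by (simp add: christoffel_def add.commute)
qed

end

section \<open>Curvature and tension field of a warped metric\<close>

text \<open>The metric dr^2/r^2 + q(r)^2 g. Absorbing the factor 1/r^2 into q makes it a warped
  product over the line with coordinate ln r.\<close>

definition warp :: "(real \<Rightarrow> real) \<Rightarrow> 'e::euclidean_space lmetric \<Rightarrow> ('e \<times> real) lmetric" where
  "warp q g z a b = snd a * snd b / (snd z)\<^sup>2 + (q (snd z))\<^sup>2 * g (fst z) (fst a) (fst b)"

text \<open>The product rule for separated variables. It serves the metric components, the
  Christoffel symbols and the monomials f(x) r^m of the boundary expansions.\<close>

lemma pd_fst_mult_snd: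
  fixes a :: "'a::real_normed_vector \<Rightarrow> real" and b :: "real \<Rightarrow> real"
  assumes "a differentiable (at x)" and "(b has_real_derivative b') (at r)"
  shows "((\<lambda>z. a (fst z) * b (snd z)) has_derivative
      (\<lambda>v. pd a (fst v) x * b r + a x * (b' * snd v))) (at (x, r))"
    and "pd (\<lambda>z. a (fst z) * b (snd z)) v (x, r) = pd a (fst v) x * b r + a x * (b' * snd v)"
proof -
  have 1: "((\<lambda>z::'a \<times> real. a (fst z)) has_derivative (\<lambda>v. pd a (fst v) x)) (at (x, r))"
    using has_derivative_compose[OF has_derivative_fst[OF has_derivative_ident], of a _ "(x, r)"]
      pd_has_derivative[OF assms(1)] by simp
  have 2: "((\<lambda>z::'a \<times> real. b (snd z)) has_derivative (\<lambda>v. b' * snd v)) (at (x, r))"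
    using DERIV_compose_FDERIV[OF _ has_derivative_snd[OF has_derivative_ident], of b b' "(x, r)" UNIV]
      assms(2) by (simp add: mult.commute)
  show 3: "((\<lambda>z. a (fst z) * b (snd z)) has_derivative
      (\<lambda>v. pd a (fst v) x * b r + a x * (b' * snd v))) (at (x, r))"
    using has_derivative_mult[OF 1 2] by (simp add: algebra_simps)
  show "pd (\<lambda>z. a (fst z) * b (snd z)) v (x, r) = pd a (fst v) x * b r + a x * (b' * snd v)"
    by (rule pd_eqI[OF 3])
qed

lemma pd_const [simp]: "pd (\<lambda>_. c) v x = 0"
  by (rule pd_eqI) simp

lemma pd_0_right: "f differentiable (at x) \<Longrightarrow> pd f 0 x = 0"
  using pd_has_derivative has_derivative_linear linear_0 by blast

text \<open>Curvature involves two derivatives of the metric, hence \<open>q1\<close> and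
  \<open>q2\<close>; positivity of q keeps the metric on the slices invertible.\<close>

locale warped_metric = local_metric S g
  for S :: "'e::euclidean_space set" and g :: "'e lmetric" +
  fixes \<epsilon> :: real and q q1 q2 :: "real \<Rightarrow> real"
  assumes q_pos: "r \<in> {0<..<\<epsilon>} \<Longrightarrow> 0 < q r"
    and q_deriv: "r \<in> {0<..<\<epsilon>} \<Longrightarrow> (q has_real_derivative q1 r) (at r)"
    and q1_deriv: "r \<in> {0<..<\<epsilon>} \<Longrightarrow> (q1 has_real_derivative q2 r) (at r)"
begin

abbreviation T where "T \<equiv> S \<times> {0<..<\<epsilon>}"

lemma open_T: "open T"
  using open_S by (intro open_Times) auto

text \<open>The metric is block diagonal, so it is inverted block by block; injectivity together
  with one explicit preimage determines the value of \<open>inv\<close>.\<close>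

lemma inv_metric_warp:
  assumes "x \<in> S" "r \<in> {0<..<\<epsilon>}"
  shows "inv_metric (warp q g) (x, r) i j = (raise x (fst i) /\<^sub>R (q r)\<^sup>2) \<bullet> fst j + r\<^sup>2 * snd i * snd j"
proof -
  have qr: "q r \<noteq> 0" "r \<noteq> 0" using q_pos[OF assms(2)] assms(2) by auto
  let ?L = "\<lambda>a. \<Sum>b\<in>Basis. warp q g (x, r) a b *\<^sub>R b"
  have L: "?L a = ((q r)\<^sup>2 *\<^sub>R lower x (fst a), snd a / r\<^sup>2)" for a
    using bilinear_rzero[OF bilin[OF assms(1)]]
    by (simp add: sum_Basis_prod warp_def lower_def prod_eq_iff fst_sum snd_sum scaleR_sum_right)
  have "inj ?L"
    using inj_lower[OF assms(1)] qr by (auto simp: inj_def L)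
  moreover have "?L (raise x (fst i) /\<^sub>R (q r)\<^sup>2, r\<^sup>2 * snd i) = i"
    using qr lower_raise[OF assms(1)]
    by (simp add: L prod_eq_iff linear_scale[OF linear_lower[OF assms(1)]])
  ultimately have "inv ?L i = (raise x (fst i) /\<^sub>R (q r)\<^sup>2, r\<^sup>2 * snd i)"
    by (rule inv_f_eq)
  then show ?thesis by (cases j) (simp add: inv_metric_def)
qed

text \<open>Basis vectors of the product have one zero component, so \<open>warp\<close> evaluates g
  at 0. These terms vanish identically near x, and so do their derivatives.\<close>

lemma pd_metric_0:
  assumes "x \<in> S"
  shows "pd (\<lambda>y. g y 0 b) v x = 0" "pd (\<lambda>y. g y a 0) v x = 0" "pd (\<lambda>y. g y a b) 0 x = 0"
    "g x 0 b = 0" "g x a 0 = 0"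
proof -
  show "pd (\<lambda>y. g y 0 b) v x = 0"
    by (subst pd_cong[OF open_S assms, of _ "\<lambda>_. 0"]) (auto simp: bilin bilinear_lzero)
  show "pd (\<lambda>y. g y a 0) v x = 0"
    by (subst pd_cong[OF open_S assms, of _ "\<lambda>_. 0"]) (auto simp: bilin bilinear_rzero)
  show "pd (\<lambda>y. g y a b) 0 x = 0"
    by (rule pd_0_right[OF smooth_on_differentiable[OF smooth assms]])
  show "g x 0 b = 0" "g x a 0 = 0"
    using bilin[OF assms] by (simp_all add: bilinear_lzero bilinear_rzero)
qed

lemma pd_warp:
  assumes "x \<in> S" "r \<in> {0<..<\<epsilon>}"
  shows "pd (\<lambda>z. warp q g z a b) v (x, r) =
    - 2 * snd a * snd b * snd v / r ^ 3 + 2 * q r * q1 r * snd v * g x (fst a) (fst b)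
    + (q r)\<^sup>2 * pd (\<lambda>y. g y (fst a) (fst b)) (fst v) x"
proof -
  have r: "r \<noteq> 0" using assms by auto
  have 1: "((\<lambda>r. inverse (r\<^sup>2)) has_real_derivative - 2 / r ^ 3) (at r)"
    using r by (auto intro!: derivative_eq_intros simp: field_simps eval_nat_numeral)
  have 2: "((\<lambda>r. (q r)\<^sup>2) has_real_derivative 2 * q r * q1 r) (at r)"
    by (rule derivative_eq_intros q_deriv[OF assms(2)] refl | simp)+
  have "((\<lambda>z. (snd a * snd b) * inverse ((snd z)\<^sup>2) + g (fst z) (fst a) (fst b) * (q (snd z))\<^sup>2) has_derivative
    (\<lambda>v. pd (\<lambda>_. snd a * snd b) (fst v) x * inverse (r\<^sup>2) + (snd a * snd b) * (- 2 / r ^ 3 * snd v)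
      + (pd (\<lambda>y. g y (fst a) (fst b)) (fst v) x * (q r)\<^sup>2 + g x (fst a) (fst b) * (2 * q r * q1 r * snd v)))) (at (x, r))"
    by (intro has_derivative_add pd_fst_mult_snd 1 2 smooth_on_differentiable[OF smooth assms(1)]) simp
  from pd_eqI[OF this, of v] show ?thesis
    by (simp add: warp_def divide_inverse mult_ac)
qed

text \<open>Only the normal derivative of q^2 g couples the slices to the r-direction; it yields the
  symbols with exactly one normal index, that is, the second fundamental form and the shape
  operator. The coefficient of dr^2 is independent of x, so two normal indices give 0, and three
  give the symbol of the line. The function of x is written first in the second formula so that the
  product rule of \<open>pd_christoffel_warp\<close> applies to it.\<close>

lemma christoffel_warp:
  assumes x: "x \<in> S" "r \<in> {0<..<\<epsilon>}" and b: "i \<in> Basis" "j \<in> Basis" "k \<in> Basis"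
  shows "christoffel (warp q g) (x, r) (i, 0) (j, 0) (k, 0) = christoffel g x i j k"
    "christoffel (warp q g) (x, r) (i, 0) (j, 0) (0, 1) = g x i j * - (r\<^sup>2 * q r * q1 r)"
    "christoffel (warp q g) (x, r) (i, 0) (0, 1) (k, 0) = (if k = i then q1 r / q r else 0)"
    "christoffel (warp q g) (x, r) (0, 1) (i, 0) (k, 0) = (if k = i then q1 r / q r else 0)"
    "christoffel (warp q g) (x, r) (i, 0) (0, 1) (0, 1) = 0"
    "christoffel (warp q g) (x, r) (0, 1) (i, 0) (0, 1) = 0"
    "christoffel (warp q g) (x, r) (0, 1) (0, 1) (k, 0) = 0"
    "christoffel (warp q g) (x, r) (0, 1) (0, 1) (0, 1) = - inverse r"
proof -
  have qr: "q r \<noteq> 0" "r \<noteq> 0" using q_pos[OF x(2)] x(2) by auto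
  have 0: "raise x 0 = 0"
    using raise_eqI[OF x(1), of 0 0] linear_0[OF linear_lower[OF x(1)]] by simp
  have inv: "inv_metric (warp q g) (x, r) (a, 0) (l, 0) = inv_metric g x a l / (q r)\<^sup>2"
    "inv_metric (warp q g) (x, r) (a, 0) (0, 1) = 0"
    "inv_metric (warp q g) (x, r) (0, 1) (l, 0) = 0"
    "inv_metric (warp q g) (x, r) (0, 1) (0, 1) = r\<^sup>2" for a l
    using inv_metric_warp[OF x] by (simp_all add: inv_metric_raise 0 divide_inverse)
  \<comment> \<open>Contracting the inverse metric with the metric leaves a Kronecker delta: the
    slices are umbilic.\<close>
  have contract: "(\<Sum>l\<in>Basis. inv_metric g x k l / (q r)\<^sup>2 * (c * g x i l)) / 2
     = (if k = i then c / (2 * (q r)\<^sup>2) else 0)" for c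
  proof -
    have "(\<Sum>l\<in>Basis. inv_metric g x k l / (q r)\<^sup>2 * (c * g x i l))
       = c / (q r)\<^sup>2 * (\<Sum>l\<in>Basis. inv_metric g x k l * g x i l)"
      by (simp add: sum_distrib_left mult_ac)
    then show ?thesis using b by (simp add: inv_metric_contract[OF x(1)] inner_Basis)
  qed
  note simps = christoffel_def sum_Basis_prod inv pd_warp[OF x] pd_metric_0[OF x(1)]
  have "(\<Sum>l\<in>Basis. inv_metric g x k l / (q r)\<^sup>2 *
         ((q r)\<^sup>2 * a l + (q r)\<^sup>2 * b l - (q r)\<^sup>2 * c l)) = (\<Sum>l\<in>Basis. inv_metric g x k l * (a l + b l - c l))"
      for a b c :: "'e \<Rightarrow> real"
    using qr by (intro sum.cong) (auto simp: field_simps)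
  then show "christoffel (warp q g) (x, r) (i, 0) (j, 0) (k, 0) = christoffel g x i j k"
    by (simp add: simps)
  show "christoffel (warp q g) (x, r) (i, 0) (j, 0) (0, 1) = g x i j * - (r\<^sup>2 * q r * q1 r)"
    by (simp add: simps)
  show "christoffel (warp q g) (x, r) (i, 0) (0, 1) (k, 0) = (if k = i then q1 r / q r else 0)"
    using contract[of "2 * q r * q1 r"] qr by (simp add: simps power2_eq_square)
  show "christoffel (warp q g) (x, r) (0, 1) (i, 0) (k, 0) = (if k = i then q1 r / q r else 0)"
    using contract[of "2 * q r * q1 r"] qr by (simp add: simps power2_eq_square)
  show "christoffel (warp q g) (x, r) (i, 0) (0, 1) (0, 1) = 0"
    "christoffel (warp q g) (x, r) (0, 1) (i, 0) (0, 1) = 0"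
    "christoffel (warp q g) (x, r) (0, 1) (0, 1) (k, 0) = 0"
    by (simp_all add: simps)
  show "christoffel (warp q g) (x, r) (0, 1) (0, 1) (0, 1) = - inverse r"
    using qr by (simp add: simps field_simps eval_nat_numeral)
qed

text \<open>The second and the last formula are restricted to the directions in which the curvature
  formula differentiates these symbols.\<close>

lemma pd_christoffel_warp:
  assumes x: "x \<in> S" "r \<in> {0<..<\<epsilon>}" and b: "i \<in> Basis" "j \<in> Basis" "k \<in> Basis"
  shows "pd (\<lambda>z. christoffel (warp q g) z (i, 0) (j, 0) (k, 0)) v (x, r)
      = pd (\<lambda>y. christoffel g y i j k) (fst v) x"
    "pd (\<lambda>z. christoffel (warp q g) z (i, 0) (j, 0) (0, 1)) (0, 1) (x, r)
      = g x i j * - (2 * r * q r * q1 r + r\<^sup>2 * (q1 r)\<^sup>2 + r\<^sup>2 * q r * q2 r)"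
    "pd (\<lambda>z. christoffel (warp q g) z (i, 0) (0, 1) (k, 0)) v (x, r)
      = (if k = i then snd v * (q2 r / q r - (q1 r / q r)\<^sup>2) else 0)"
    "pd (\<lambda>z. christoffel (warp q g) z (0, 1) (i, 0) (k, 0)) v (x, r)
      = (if k = i then snd v * (q2 r / q r - (q1 r / q r)\<^sup>2) else 0)"
    "pd (\<lambda>z. christoffel (warp q g) z (i, 0) (0, 1) (0, 1)) v (x, r) = 0"
    "pd (\<lambda>z. christoffel (warp q g) z (0, 1) (i, 0) (0, 1)) v (x, r) = 0"
    "pd (\<lambda>z. christoffel (warp q g) z (0, 1) (0, 1) (k, 0)) v (x, r) = 0"
    "pd (\<lambda>z. christoffel (warp q g) z (0, 1) (0, 1) (0, 1)) (l, 0) (x, r) = 0"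
proof -
  have qr: "q r \<noteq> 0" "r \<noteq> 0" using q_pos[OF x(2)] x(2) by auto
  have zT: "(x, r) \<in> T" using x by simp
  \<comment> \<open>The symbols are known on all of the open set \<open>T\<close>, so their product
    form may be differentiated at (x, r).\<close>
  have eqI: "pd F v (x, r) = pd a (fst v) x * c r + a x * (c' * snd v)"
    if "a differentiable (at x)" "(c has_real_derivative c') (at r)"
      "\<And>y s. y \<in> S \<Longrightarrow> s \<in> {0<..<\<epsilon>} \<Longrightarrow> F (y, s) = a y * c s" for F a c c' v
  proof -
    have "pd F v (x, r) = pd (\<lambda>z. a (fst z) * c (snd z)) v (x, r)"
      by (rule pd_cong[OF open_T zT]) (use that(3) in auto)
    then show ?thesis using pd_fst_mult_snd(2)[OF that(1,2)] by simp
  qed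
  show "pd (\<lambda>z. christoffel (warp q g) z (i, 0) (j, 0) (k, 0)) v (x, r)
      = pd (\<lambda>y. christoffel g y i j k) (fst v) x"
    by (subst eqI[where c = "\<lambda>_. 1" and c' = 0, OF differentiable_christoffel])
      (use x b in \<open>auto simp: christoffel_warp\<close>)
  have "((\<lambda>r. - (r\<^sup>2 * q r * q1 r)) has_real_derivative
      - (2 * r * q r * q1 r + r\<^sup>2 * (q1 r)\<^sup>2 + r\<^sup>2 * q r * q2 r)) (at r)"
    by (rule derivative_eq_intros q_deriv q1_deriv x refl | simp add: power2_eq_square algebra_simps)+
  from eqI[OF smooth_on_differentiable[OF smooth x(1)] this christoffel_warp(2)[OF _ _ b], of "(0, 1)"]
  show "pd (\<lambda>z. christoffel (warp q g) z (i, 0) (j, 0) (0, 1)) (0, 1) (x, r)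
      = g x i j * - (2 * r * q r * q1 r + r\<^sup>2 * (q1 r)\<^sup>2 + r\<^sup>2 * q r * q2 r)"
    by (simp add: pd_metric_0[OF x(1)])
  have dp: "((\<lambda>r. q1 r / q r) has_real_derivative q2 r / q r - (q1 r / q r)\<^sup>2) (at r)"
    using qr by (auto intro!: derivative_eq_intros q_deriv q1_deriv x simp: field_simps power2_eq_square)
  then have d: "((\<lambda>r. if k = i then q1 r / q r else 0) has_real_derivative
      (if k = i then q2 r / q r - (q1 r / q r)\<^sup>2 else 0)) (at r)"
    by auto
  show "pd (\<lambda>z. christoffel (warp q g) z (i, 0) (0, 1) (k, 0)) v (x, r)
      = (if k = i then snd v * (q2 r / q r - (q1 r / q r)\<^sup>2) else 0)"
    by (subst eqI[where a = "\<lambda>_. 1", OF _ d]) (use christoffel_warp b in auto)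
  show "pd (\<lambda>z. christoffel (warp q g) z (0, 1) (i, 0) (k, 0)) v (x, r)
      = (if k = i then snd v * (q2 r / q r - (q1 r / q r)\<^sup>2) else 0)"
    by (subst eqI[where a = "\<lambda>_. 1", OF _ d]) (use christoffel_warp b in auto)
  show "pd (\<lambda>z. christoffel (warp q g) z (i, 0) (0, 1) (0, 1)) v (x, r) = 0"
    by (subst eqI[where a = "\<lambda>_. 1" and c = "\<lambda>_. 0" and c' = 0]) (use christoffel_warp b in auto)
  show "pd (\<lambda>z. christoffel (warp q g) z (0, 1) (i, 0) (0, 1)) v (x, r) = 0"
    by (subst eqI[where a = "\<lambda>_. 1" and c = "\<lambda>_. 0" and c' = 0]) (use christoffel_warp b in auto)
  show "pd (\<lambda>z. christoffel (warp q g) z (0, 1) (0, 1) (k, 0)) v (x, r) = 0"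
    by (subst eqI[where a = "\<lambda>_. 1" and c = "\<lambda>_. 0" and c' = 0]) (use christoffel_warp b in auto)
  have "((\<lambda>r. - inverse r) has_real_derivative inverse r ^ 2) (at r)"
    using qr by (auto intro!: derivative_eq_intros simp: power2_eq_square)
  from eqI[where a = "\<lambda>_. 1", OF _ this, of _ "(l, 0)"]
  show "pd (\<lambda>z. christoffel (warp q g) z (0, 1) (0, 1) (0, 1)) (l, 0) (x, r) = 0"
    using christoffel_warp(8) b by auto
qed

end

text \<open>Contractions with a Kronecker delta, one variant for each position of the delta and
  orientation of its equation.\<close>

lemma sum_Basis_if:
  fixes f :: "'e::euclidean_space \<Rightarrow> real"
  assumes "k \<in> Basis"
  shows "(\<Sum>m\<in>Basis. f m * (if m = k then c else 0)) = f k * c"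
    "(\<Sum>m\<in>Basis. (if m = k then c else 0) * f m) = c * f k"
    "(\<Sum>m\<in>Basis. (if k = m then c else 0) * f m) = c * f k"
  using assms by (simp_all add: if_distrib if_distribR cong: if_cong)

section \<open>Ricci curvature and codifferential in the warped metric\<close>

context warped_metric
begin

text \<open>With a prime for r d/dr, so that q' = r q1 and q'' = r q1 + r^2 q2, this is the
  classical warped product formula: the slices get Ric - ((n - 1) q'^2 + q q'') g, the unit normal
  gets -n q''/q.\<close>

lemma ricci_warp:
  assumes x: "x \<in> S" "r \<in> {0<..<\<epsilon>}" and b: "j \<in> Basis" "k \<in> Basis"
  shows "ricci (warp q g) (x, r) (j, 0) (k, 0) = ricci g x j k
      - (real (DIM('e)) * (r * q1 r)\<^sup>2 - (r * q1 r)\<^sup>2 + r * q r * q1 r + r\<^sup>2 * q r * q2 r) * g x j k"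
    and "ricci (warp q g) (x, r) (0, 1) (k, 0) = 0"
    and "ricci (warp q g) (x, r) (j, 0) (0, 1) = 0"
    and "ricci (warp q g) (x, r) (0, 1) (0, 1) = - real (DIM('e)) * (q2 r / q r + q1 r / (r * q r))"
proof -
  have qr: "q r \<noteq> 0" "r \<noteq> 0" using q_pos[OF x(2)] x(2) by auto
  let ?p = "q1 r / q r" and ?A = "- (r\<^sup>2 * q r * q1 r)"
  let ?A' = "- (2 * r * q r * q1 r + r\<^sup>2 * (q1 r)\<^sup>2 + r\<^sup>2 * q r * q2 r)"
  have 1: "riemann (warp q g) (x, r) (i, 0) (j, 0) (k, 0) (i, 0)
    = riemann g x i j k i + ?p * (g x j k * ?A) - (if i = j then ?p else 0) * (g x i k * ?A)" if "i \<in> Basis" for i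
    using that b
    by (simp add: riemann_def sum_Basis_prod christoffel_warp[OF x] pd_christoffel_warp[OF x] sum.distrib
        sum_subtractf cong: sum.cong)
  have "(\<Sum>m\<in>Basis. christoffel (warp q g) (x, r) (0, 1) (m, 0) (0, 1) * christoffel (warp q g) (x, r) (j, 0) (k, 0) (m, 0)
     - christoffel (warp q g) (x, r) (j, 0) (m, 0) (0, 1) * christoffel (warp q g) (x, r) (0, 1) (k, 0) (m, 0))
     = (\<Sum>m\<in>Basis. - (g x j m * ?A) * (if m = k then ?p else 0))"
    by (rule sum.cong[OF refl]) (use b in \<open>simp add: christoffel_warp[OF x]\<close>)
  also have "\<dots> = - (g x j k * ?A) * ?p"
    by (rule sum_Basis_if[OF b(2)])
  finally have 2: "riemann (warp q g) (x, r) (0, 1) (j, 0) (k, 0) (0, 1)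
    = g x j k * ?A' - g x j k * ?A * ?p - inverse r * (g x j k * ?A)"
    using b by (simp add: riemann_def sum_Basis_prod christoffel_warp[OF x] pd_christoffel_warp[OF x])
  \<comment> \<open>The Gauss equation, traced: each direction adds \<open>?p * ?A\<close> times the
    metric, except that the delta cancels this for i = j. The factor is thus n - 1.\<close>
  have "(\<Sum>i\<in>Basis. riemann (warp q g) (x, r) (i, 0) (j, 0) (k, 0) (i, 0))
     = ricci g x j k + DIM('e) * (?p * (g x j k * ?A)) - ?p * (g x j k * ?A)"
  proof -
    have "(\<Sum>i\<in>Basis. riemann (warp q g) (x, r) (i, 0) (j, 0) (k, 0) (i, 0))
      = (\<Sum>i\<in>Basis. riemann g x i j k i + ?p * (g x j k * ?A) - (if i = j then ?p else 0) * (g x i k * ?A))"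
      by (rule sum.cong[OF refl 1])
    then show ?thesis
      unfolding sum_subtractf sum.distrib sum_Basis_if(2)[OF b(1), of ?p "\<lambda>i. g x i k * ?A"] ricci_def
      by simp
  qed
  then have "ricci (warp q g) (x, r) (j, 0) (k, 0)
     = ricci g x j k + (DIM('e) * ?p * ?A - ?p * ?A + ?A' - ?A * ?p - inverse r * ?A) * g x j k"
    unfolding ricci_def[of "warp q g"] sum_Basis_prod 2 by (simp add: algebra_simps del: times_divide_eq_left times_divide_eq_right)
  also have "DIM('e) * ?p * ?A - ?p * ?A + ?A' - ?A * ?p - inverse r * ?A
     = - (real (DIM('e)) * (r * q1 r)\<^sup>2 - (r * q1 r)\<^sup>2 + r * q r * q1 r + r\<^sup>2 * q r * q2 r)"
    using qr by (simp add: field_simps power2_eq_square)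
  finally show "ricci (warp q g) (x, r) (j, 0) (k, 0) = ricci g x j k
      - (real (DIM('e)) * (r * q1 r)\<^sup>2 - (r * q1 r)\<^sup>2 + r * q r * q1 r + r\<^sup>2 * q r * q2 r) * g x j k"
    by (simp only: mult_minus_left add_uminus_conv_diff)
  \<comment> \<open>A Codazzi equation: the shape operator is a multiple of the identity that
    depends on r alone, so the two contractions with the symbols of g cancel.\<close>
  have "riemann (warp q g) (x, r) (i, 0) (0, 1) (k, 0) (i, 0) = 0" if i: "i \<in> Basis" for i
  proof -
    have "(\<Sum>m\<in>Basis. christoffel (warp q g) (x, r) (i, 0) (m, 0) (i, 0) * christoffel (warp q g) (x, r) (0, 1) (k, 0) (m, 0)
     - christoffel (warp q g) (x, r) (0, 1) (m, 0) (i, 0) * christoffel (warp q g) (x, r) (i, 0) (k, 0) (m, 0))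
     = (\<Sum>m\<in>Basis. christoffel g x i m i * (if m = k then ?p else 0) - (if i = m then ?p else 0) * christoffel g x i k m)"
      by (rule sum.cong[OF refl]) (use b i in \<open>simp add: christoffel_warp[OF x]\<close>)
    also have "\<dots> = 0"
      unfolding sum_subtractf using b i by (simp only: sum_Basis_if) simp
    finally show ?thesis
      using b i pd_0_right[OF differentiable_christoffel[OF x(1)]]
      by (simp add: riemann_def sum_Basis_prod christoffel_warp[OF x] pd_christoffel_warp[OF x])
  qed
  moreover have "riemann (warp q g) (x, r) (0, 1) (0, 1) (k, 0) (0, 1) = 0"
    by (simp add: riemann_def)
  ultimately show "ricci (warp q g) (x, r) (0, 1) (k, 0) = 0"
    unfolding ricci_def sum_Basis_prod by simp
  \<comment> \<open>What survives is a torsion term, which symmetry of the Christoffel symbols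
    removes.\<close>
  have "riemann (warp q g) (x, r) (i, 0) (j, 0) (0, 1) (i, 0)
     = ?p * (christoffel g x i j i - christoffel g x j i i)" if i: "i \<in> Basis" for i
  proof -
    have "(\<Sum>m\<in>Basis. christoffel (warp q g) (x, r) (i, 0) (m, 0) (i, 0) * christoffel (warp q g) (x, r) (j, 0) (0, 1) (m, 0)
     - christoffel (warp q g) (x, r) (j, 0) (m, 0) (i, 0) * christoffel (warp q g) (x, r) (i, 0) (0, 1) (m, 0))
     = (\<Sum>m\<in>Basis. christoffel g x i m i * (if m = j then ?p else 0) - christoffel g x j m i * (if m = i then ?p else 0))"
      by (rule sum.cong[OF refl]) (use b i in \<open>simp add: christoffel_warp[OF x]\<close>)
    also have "\<dots> = ?p * (christoffel g x i j i - christoffel g x j i i)"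
      unfolding sum_subtractf using b i by (simp only: sum_Basis_if) (simp add: algebra_simps)
    finally show ?thesis
      using b i
      by (simp add: riemann_def sum_Basis_prod christoffel_warp[OF x] pd_christoffel_warp[OF x])
  qed
  moreover have "riemann (warp q g) (x, r) (0, 1) (j, 0) (0, 1) (0, 1) = 0"
    using b by (simp add: riemann_def sum_Basis_prod christoffel_warp[OF x] pd_christoffel_warp[OF x] cong: sum.cong)
  ultimately show "ricci (warp q g) (x, r) (j, 0) (0, 1) = 0"
    unfolding ricci_def sum_Basis_prod using christoffel_sym[OF x(1)] by simp
  have "riemann (warp q g) (x, r) (i, 0) (0, 1) (0, 1) (i, 0) = - (q2 r / q r + q1 r / (r * q r))" if i: "i \<in> Basis" for i
  proof -
    have "(\<Sum>m\<in>Basis. christoffel (warp q g) (x, r) (i, 0) (m, 0) (i, 0) * christoffel (warp q g) (x, r) (0, 1) (0, 1) (m, 0)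
     - christoffel (warp q g) (x, r) (0, 1) (m, 0) (i, 0) * christoffel (warp q g) (x, r) (i, 0) (0, 1) (m, 0))
     = (\<Sum>m\<in>Basis. - (if i = m then ?p else 0) * (if m = i then ?p else 0))"
      by (rule sum.cong[OF refl]) (use b i in \<open>simp add: christoffel_warp[OF x]\<close>)
    also have "\<dots> = - ?p * ?p"
      using sum_Basis_if(1)[OF i, of "\<lambda>m. - (if i = m then ?p else 0)" ?p] by simp
    finally show ?thesis
      using b i qr
      by (simp add: riemann_def sum_Basis_prod christoffel_warp[OF x] pd_christoffel_warp[OF x])
        (simp add: field_simps power2_eq_square)
  qed
  moreover have "riemann (warp q g) (x, r) (0, 1) (0, 1) (0, 1) (0, 1) = 0"
    by (simp add: riemann_def)
  ultimately show "ricci (warp q g) (x, r) (0, 1) (0, 1) = - real (DIM('e)) * (q2 r / q r + q1 r / (r * q r))"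
    unfolding ricci_def sum_Basis_prod by (simp add: right_diff_distrib distrib_left)
qed

lemma codiff_warp:
  fixes u :: "'e \<Rightarrow> 'f::euclidean_space"
  assumes x: "x \<in> S" "r \<in> {0<..<\<epsilon>}" and V: "open V" "x \<in> V" "smooth_on u V"
  shows "codiff (warp q g) H (\<lambda>z. u (fst z)) (pd (\<lambda>z. u (fst z))) (x, r)
    = codiff g H u (pd u) x /\<^sub>R (q r)\<^sup>2"
proof -
  let ?u = "\<lambda>z::'e \<times> real. u (fst z)"
  have op: "open (V \<times> (UNIV::real set))" using V(1) by (intro open_Times) auto
  have 0: "raise x 0 = 0"
    using raise_eqI[OF x(1), of 0 0] linear_0[OF linear_lower[OF x(1)]] by simp
  have inv: "inv_metric (warp q g) (x, r) (a, 0) (l, 0) = inv_metric g x a l / (q r)\<^sup>2"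
    "inv_metric (warp q g) (x, r) (a, 0) (0, 1) = 0"
    "inv_metric (warp q g) (x, r) (0, 1) (l, 0) = 0" for a l
    using inv_metric_warp[OF x] by (simp_all add: inv_metric_raise 0 divide_inverse)
  have d: "u differentiable (at y)" if "y \<in> V" for y
    using smooth_on_differentiable[OF V(3) that] .
  have pd_u: "pd ?u a (y, s) = pd u (fst a) y" if "y \<in> V" for a y s
    using pd_comp_fst[of u "(y, s)"] d[OF that] by simp
  \<comment> \<open>The outer derivative requires the formula for the inner one on a neighbourhood,
    which is what the open set V provides.\<close>
  have pd_base: "pd (pd ?u (j, 0)) (i, 0) (x, r) = pd (pd u j) i x" if "j \<in> Basis" for i j
  proof -
    have "pd (pd ?u (j, 0)) (i, 0) (x, r) = pd (\<lambda>z. pd u j (fst z)) (i, 0) (x, r)"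
      by (rule pd_cong[OF op]) (use V in \<open>auto simp: pd_u\<close>)
    then show ?thesis
      using pd_comp_fst[of "pd u j" "(x, r)"] smooth_on_differentiable[OF smooth_on_pd[OF V(3) that] V(2)] by simp
  qed
  have "pd (pd ?u (0, 1)) (0, 1) (x, r) = pd (\<lambda>z. 0) (0, 1) (x, r)"
    by (rule pd_cong[OF op]) (use V d in \<open>auto simp: pd_u pd_0_right\<close>)
  then have normal: "nabla (warp q g) H ?u (pd ?u) (x, r) (0, 1) (0, 1) = 0"
    using V d
    by (simp add: nabla_def sum_Basis_prod christoffel_warp[OF x] pd_u pd_0_right christoffel_vec_def
        cong: sum.cong)
  have "nabla (warp q g) H ?u (pd ?u) (x, r) (i, 0) (j, 0) = nabla g H u (pd u) x i j"
    if "i \<in> Basis" "j \<in> Basis" for i j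
    using that V d
    by (simp add: nabla_def sum_Basis_prod christoffel_warp[OF x] pd_u pd_0_right pd_base
        cong: sum.cong)
  then show ?thesis
    unfolding codiff_def sum_Basis_prod
    by (simp add: inv normal scaleR_sum_right divide_inverse mult.commute cong: sum.cong)
qed

end

text \<open>The codifferential of a tangent map involves two derivatives of u and so only its germ
  at x. This allows replacing a coordinate representation that is known only over an open part of
  the chart.\<close>

lemma codiff_cong:
  assumes "open V" "x \<in> V" "\<And>y. y \<in> V \<Longrightarrow> u y = v y"
  shows "codiff G H u (pd u) x = codiff G H v (pd v) x"
proof -
  have 1: "pd u a y = pd v a y" if "y \<in> V" for a y
    by (rule pd_cong[OF assms(1) that assms(3)])
  have "pd (pd u a) b x = pd (pd v a) b x" for a b
    by (rule pd_cong[OF assms(1,2) 1])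
  then show ?thesis
    using assms 1 by (simp add: codiff_def nabla_def)
qed

section \<open>Boundary asymptotics and cylinder charts\<close>

lemma bdry_O_zero:
  assumes "0 < \<epsilon>" "\<And>x r. x \<in> S \<Longrightarrow> r \<in> {0<..<\<epsilon>} \<Longrightarrow> F (x, r) = 0"
  shows "bdry_O S b F"
  unfolding bdry_O_def
proof (intro allI impI)
  fix K assume "compact K \<and> K \<subseteq> S"
  then have "\<forall>x\<in>K. \<forall>r\<in>{0<..<\<epsilon>}. norm (F (x, r)) \<le> 0 * \<bar>b r\<bar>"
    using assms(2) by (auto simp: subset_iff)
  then show "\<exists>C r0. 0 < r0 \<and> (\<forall>x\<in>K. \<forall>r\<in>{0<..<r0}. norm (F (x, r)) \<le> C * \<bar>b r\<bar>)"
    using assms(1) by blast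
qed

text \<open>Vanishing on a collar passes to every derivative in \<open>bdry_O_k\<close>, and then
  the constant 0 serves for any order \<open>b\<close>.\<close>

lemma bdry_O_smooth_zero:
  assumes S: "open S" and "0 < \<epsilon>" "\<And>x r. x \<in> S \<Longrightarrow> r \<in> {0<..<\<epsilon>} \<Longrightarrow> F (x, r) = 0"
  shows "bdry_O_smooth S b F"
proof -
  have op: "open (S \<times> {0<..<\<epsilon>})" using S by (intro open_Times) auto
  have "bdry_O_k k S b F" for k
    using assms(3)
  proof (induction k arbitrary: F)
    case 0
    show ?case
      by (simp only: bdry_O_k.simps) (rule bdry_O_zero[where F = F, OF assms(2) 0])
  next
    case (Suc k)
    have pd0: "pd F v (x, r) = 0" if "x \<in> S" "r \<in> {0<..<\<epsilon>}" for v x r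
    proof -
      have "pd F v (x, r) = pd (\<lambda>_. 0) v (x, r)"
        by (rule pd_cong[OF op]) (use that Suc.prems in auto)
      then show ?thesis by simp
    qed
    show ?case
      unfolding bdry_O_k.simps
    proof (intro conjI ballI)
      show "bdry_O S b F"
        by (rule bdry_O_zero[where F = F, OF assms(2) Suc.prems])
      show "bdry_O_k k S b (pd F (a, 0))" for a
        by (rule Suc.IH) (rule pd0)
      show "bdry_O_k k S b (\<lambda>z. snd z *\<^sub>R pd F (0, 1) z)"
        by (rule Suc.IH) (simp add: pd0 del: greaterThanLessThan_iff)
    qed
  qed
  then show ?thesis by (simp add: bdry_O_smooth_def)
qed

text \<open>The functions f(x) r^m with m fixed are closed under the operations of
  \<open>bdry_O_k\<close>: an x-derivative changes only f, and r d/dr multiplies f by m. Hence the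
  induction with f arbitrary.\<close>

lemma bdry_O_smooth_monomial:
  fixes f :: "'e::euclidean_space \<Rightarrow> real"
  assumes S: "open S" and "0 < \<epsilon>" "smooth_on f S" "N \<le> m"
    and "\<And>x r. x \<in> S \<Longrightarrow> r \<in> {0<..<\<epsilon>} \<Longrightarrow> F (x, r) = f x * r ^ m"
  shows "bdry_O_smooth S (\<lambda>r. r ^ N) F"
proof -
  have op: "open (S \<times> {0<..<\<epsilon>})" using S by (intro open_Times) auto
  have base: "bdry_O S (\<lambda>r. r ^ N) F" if f: "smooth_on f S"
     and F: "\<And>x r. x \<in> S \<Longrightarrow> r \<in> {0<..<\<epsilon>} \<Longrightarrow> F (x, r) = f x * r ^ m" for f :: "'e \<Rightarrow> real" and F
    unfolding bdry_O_def
  proof (intro allI impI)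
    fix K assume K: "compact K \<and> K \<subseteq> S"
    then have "bounded (f ` K)"
      by (intro compact_imp_bounded compact_continuous_image)
        (auto intro: continuous_on_subset[OF smooth_on_continuous_on[OF f]])
    then obtain C where C: "\<And>x. x \<in> K \<Longrightarrow> \<bar>f x\<bar> \<le> C"
      by (auto simp: bounded_iff)
    \<comment> \<open>The bound 1 on r lets the higher power be estimated by the lower one.\<close>
    have "norm (F (x, r)) \<le> C * \<bar>r ^ N\<bar>" if "x \<in> K" "r \<in> {0<..<min \<epsilon> 1}" for x r
    proof -
      have "norm (F (x, r)) = \<bar>f x\<bar> * r ^ m"
        using F[of x r] that K by (auto simp: abs_mult)
      also have "\<dots> \<le> C * r ^ N"
        using C[OF that(1)] that(2) assms(4)
        by (intro mult_mono power_decreasing) auto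
      finally show ?thesis using that by simp
    qed
    then show "\<exists>C r0. 0 < r0 \<and> (\<forall>x\<in>K. \<forall>r\<in>{0<..<r0}. norm (F (x, r)) \<le> C * \<bar>r ^ N\<bar>)"
      using assms(2) by (intro exI[of _ C] exI[of _ "min \<epsilon> 1"]) auto
  qed
  have "bdry_O_k k S (\<lambda>r. r ^ N) F" for k
    using assms(3,5)
  proof (induction k arbitrary: f F)
    case 0
    from base[OF this] show ?case by simp
  next
    case (Suc k)
    have d: "((\<lambda>r. r ^ m) has_real_derivative real m * r ^ (m - 1)) (at r)" for r :: real
      using DERIV_pow[of m r] by simp
    have pdF: "pd F v (x, r) = pd f (fst v) x * r ^ m + f x * (real m * r ^ (m - 1) * snd v)"
      if "x \<in> S" "r \<in> {0<..<\<epsilon>}" for v x r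
    proof -
      have "pd F v (x, r) = pd (\<lambda>z. f (fst z) * snd z ^ m) v (x, r)"
        by (rule pd_cong[OF op]) (use that Suc.prems in auto)
      then show ?thesis
        using pd_fst_mult_snd(2)[OF smooth_on_differentiable[OF Suc.prems(1) that(1)] d] by simp
    qed
    have "bdry_O_k k S (\<lambda>r. r ^ N) (pd F (a, 0))" if "a \<in> Basis" for a
      by (rule Suc.IH[OF smooth_on_pd[OF Suc.prems(1) that]]) (simp add: pdF)
    moreover have "bdry_O_k k S (\<lambda>r. r ^ N) (\<lambda>z. snd z *\<^sub>R pd F (0, 1) z)"
    proof (rule Suc.IH)
      show "smooth_on (\<lambda>x. real m * f x) S"
        by (intro smooth_on_mult smooth_on_const S Suc.prems)
      fix x and r :: real assume x: "x \<in> S" "r \<in> {0<..<\<epsilon>}"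
      show "snd (x, r) *\<^sub>R pd F (0, 1) (x, r) = real m * f x * r ^ m"
        using pd_0_right[OF smooth_on_differentiable[OF Suc.prems(1) x(1)]]
        \<comment> \<open>For m = 0 the truncated exponent \<open>m - 1\<close> is harmless, as its
          factor \<open>real m\<close> vanishes.\<close>
        by (cases m) (simp_all add: pdF[OF x])
    qed
    ultimately show ?case using base[OF Suc.prems] by simp
  qed
  then show ?thesis by (simp add: bdry_O_smooth_def)
qed

text \<open>Tensors on the cylinder are families indexed by its charts, so the chart of \<open>M\<close> has to be
  recovered from the product chart.\<close>

definition uncyl :: "('m \<times> real, 'e \<times> real) chart \<Rightarrow> ('m, 'e) chart" where
  "uncyl C = (fst ` fst C, \<lambda>p. fst (snd C (p, 0)))"

text \<open>The value r = 0 lies outside the product chart, but \<open>cyl\<close> gives its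
  coordinate map on all pairs, so even the functions agree; a nonempty interval is what makes the
  domain projectable.\<close>

lemma uncyl_cyl: "0 < \<epsilon> \<Longrightarrow> uncyl (cyl \<epsilon> c) = c"
  by (auto simp: uncyl_def cyl_def prod_eq_iff)

lemma crange_cyl: "crange (cyl \<epsilon> c) = crange c \<times> {0<..<\<epsilon>}"
  by (force simp: crange_def cyl_def)

lemma cinv_cyl:
  assumes "inj_on (snd c) (fst c)" "x \<in> crange c" "r \<in> {0<..<\<epsilon>}"
  shows "cinv (cyl \<epsilon> c) (x, r) = (cinv c x, r)"
proof -
  obtain p where p: "p \<in> fst c" "x = snd c p" using assms(2) by (auto simp: crange_def)
  have "inj_on (snd (cyl \<epsilon> c)) (fst (cyl \<epsilon> c))"
    using assms(1) by (auto simp: inj_on_def cyl_def)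
  moreover have "(p, r) \<in> fst (cyl \<epsilon> c)" "snd (cyl \<epsilon> c) (p, r) = (x, r)"
    using p assms(3) by (auto simp: cyl_def)
  ultimately have "cinv (cyl \<epsilon> c) (x, r) = (p, r)"
    by (metis cinv_def inv_into_f_f)
  moreover have "cinv c x = p"
    using p assms(1) by (simp add: cinv_def)
  ultimately show ?thesis by simp
qed

section \<open>Charts of a manifold and transition maps of the cylinder\<close>

context
  fixes S :: "'m::{t2_space,second_countable_topology} set"
    and A :: "('m, 'e::euclidean_space) chart set"
  assumes A: "smooth_manifold S A"
begin

lemma chart_inj: "c \<in> A \<Longrightarrow> inj_on (snd c) (fst c)"
  and chart_open: "c \<in> A \<Longrightarrow> open (fst c)"
  and crange_open: "c \<in> A \<Longrightarrow> open (crange c)"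
  and transition_smooth: "c \<in> A \<Longrightarrow> c' \<in> A \<Longrightarrow>
    smooth_on (snd c' \<circ> cinv c) (snd c ` (fst c \<inter> fst c'))"
  using A by (simp_all add: smooth_manifold_def)

lemma cinv_chart: "c \<in> A \<Longrightarrow> p \<in> fst c \<Longrightarrow> cinv c (snd c p) = p"
  using chart_inj by (simp add: cinv_def)

lemma chart_image_open:
  assumes "c \<in> A" "open U"
  shows "open (snd c ` (fst c \<inter> U))"
proof -
  have "snd c ` (fst c \<inter> U) = crange c \<inter> cinv c -` U"
    using cinv_chart[OF assms(1)] by (force simp: crange_def)
  moreover have "continuous_on (crange c) (cinv c)"
    using A assms(1) by (simp add: smooth_manifold_def)
  ultimately show ?thesis
    using continuous_open_preimage crange_open[OF assms(1)] assms(2) by metis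
qed

lemma ldom_open:
  assumes "c \<in> A" "open (fst d)" "continuous_on (fst c) \<phi>"
  shows "open (ldom c d \<phi>)"
proof -
  have "{p \<in> fst c. \<phi> p \<in> fst d} = fst c \<inter> (fst c \<inter> \<phi> -` fst d)" by auto
  then show ?thesis
    unfolding ldom_def
    using chart_image_open[OF assms(1) continuous_open_preimage[OF assms(3) chart_open[OF assms(1)] assms(2)]]
    by simp
qed

lemma local_metric_chart:
  assumes "riemannian_metric A g" "c \<in> A"
  shows "local_metric (crange c) (g c)"
  using assms crange_open[OF assms(2)]
  by unfold_locales (auto simp: riemannian_metric_def symmetric_tensor_def)

text \<open>Compatibility of the zero components rests on linearity of the transition derivative,
  hence on differentiability of the transition map.\<close>

lemma tangent_vector_0: "tangent_vector A p (\<lambda>_. 0)"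
  unfolding tangent_vector_def
proof (intro ballI impI)
  fix c c' assume *: "c \<in> A" "c' \<in> A" "p \<in> fst c \<and> p \<in> fst c'"
  then have "pd (snd c' \<circ> cinv c) 0 (snd c p) = 0"
    by (intro pd_0_right smooth_on_differentiable[OF transition_smooth]) auto
  then show "0 = frechet_derivative (snd c' \<circ> cinv c) (at (snd c p)) 0"
    by (simp add: pd_def)
qed

lemma section_along_0: "section_along X A \<psi> (\<lambda>_ _. 0)"
  by (simp add: section_along_def tangent_vector_0 smooth_on_const)

text \<open>The transition map is the product of the one of M with the identity. This identification
  is made on the open product over the chart overlap, because \<open>cinv\<close> is controlled only
  on the chart range.\<close>

lemma transition_cyl:
  assumes "c \<in> A" "c' \<in> A" "p \<in> fst c" "p \<in> fst c'" "r \<in> {0<..<\<epsilon>}"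
  shows "frechet_derivative (snd (cyl \<epsilon> c') \<circ> cinv (cyl \<epsilon> c)) (at (snd c p, r)) v
    = (frechet_derivative (snd c' \<circ> cinv c) (at (snd c p)) (fst v), snd v)"
proof -
  let ?V = "snd c ` (fst c \<inter> fst c')"
  have op: "open (?V \<times> {0<..<\<epsilon>})"
    by (intro open_Times chart_image_open assms chart_open) auto
  have 1: "((snd c' \<circ> cinv c) has_derivative (\<lambda>v. pd (snd c' \<circ> cinv c) v (snd c p))) (at (fst (snd c p, r)))"
    using pd_has_derivative[OF smooth_on_differentiable[OF transition_smooth]] assms by simp
  have "((\<lambda>z. ((snd c' \<circ> cinv c) (fst z), snd z)) has_derivative
      (\<lambda>v. (pd (snd c' \<circ> cinv c) (fst v) (snd c p), snd v))) (at (snd c p, r))"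
    by (intro has_derivative_Pair has_derivative_snd has_derivative_ident
        has_derivative_compose[OF has_derivative_fst[OF has_derivative_ident] 1])
  then have "((snd (cyl \<epsilon> c') \<circ> cinv (cyl \<epsilon> c)) has_derivative
      (\<lambda>v. (pd (snd c' \<circ> cinv c) (fst v) (snd c p), snd v))) (at (snd c p, r))"
  proof (rule has_derivative_transform_within_open[OF _ op])
    fix z assume z: "z \<in> ?V \<times> {0<..<\<epsilon>}"
    then have "cinv (cyl \<epsilon> c) (fst z, snd z) = (cinv c (fst z), snd z)"
      by (intro cinv_cyl chart_inj assms) (auto simp: crange_def)
    then show "((snd c' \<circ> cinv c) (fst z), snd z) = (snd (cyl \<epsilon> c') \<circ> cinv (cyl \<epsilon> c)) z"
      by (simp add: cyl_def)
  qed (use assms in auto)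
  from pd_eqI[OF this, of v] show ?thesis
    by (simp add: pd_def)
qed

end

section \<open>The Poincare metric of an Einstein metric\<close>

text \<open>With \<open>q = profile \<mu>\<close> one has \<open>q(r)\<^sup>2 = r\<^sup>-\<^sup>2 (1 - \<mu> r\<^sup>2)\<^sup>2\<close>; \<open>\<mu>\<close> is the \<open>\<lambda>\<close> of
  \<open>Ric = 4 \<lambda> (n - 1) g\<close>, and on \<open>(0, collar \<mu>)\<close> the metric does not degenerate.\<close>

definition profile :: "real \<Rightarrow> real \<Rightarrow> real" where
  "profile \<mu> r = inverse r - \<mu> * r"

definition collar :: "real \<Rightarrow> real" where
  "collar \<mu> = inverse (1 + \<bar>\<mu>\<bar>)"

lemma collar_pos: "0 < collar \<mu>"
  by (simp add: collar_def add_pos_nonneg)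

text \<open>From r (1 + \<bar>\<mu>\<bar>) < 1 follow r < 1 and \<mu> r^2 < r, hence \<mu> r^2 < 1.
  The absolute value gives one collar width for both signs of \<mu>.\<close>

lemma profile_pos:
  assumes "r \<in> {0<..<collar \<mu>}"
  shows "0 < profile \<mu> r"
proof -
  have r: "0 < r" "r * (1 + \<bar>\<mu>\<bar>) < 1"
    using assms by (auto simp: collar_def field_simps)
  have "0 \<le> r * \<bar>\<mu>\<bar>" using r by simp
  then have "r < 1" using r(2) unfolding distrib_left by linarith
  have "r * r * \<mu> \<le> r * (r * \<bar>\<mu>\<bar>)"
    using r by (simp add: mult_left_mono)
  also have "\<dots> \<le> r * (r * (1 + \<bar>\<mu>\<bar>))"
    using r by (intro mult_left_mono) auto
  also have "\<dots> < r * 1"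
    using r by (intro mult_strict_left_mono) auto
  also have "r * 1 < 1" using \<open>r < 1\<close> by simp
  finally show ?thesis
    using r by (simp add: profile_def field_simps)
qed

lemma warped_metric_profile:
  assumes "local_metric S g"
  shows "warped_metric S g (collar \<mu>) (profile \<mu>) (\<lambda>r. - (inverse r ^ 2) - \<mu>) (\<lambda>r. 2 * inverse r ^ 3)"
proof -
  interpret local_metric S g by fact
  show ?thesis
  proof
    fix r assume r: "r \<in> {0<..<collar \<mu>}"
    then have "r \<noteq> 0" by auto
    then show "(profile \<mu> has_real_derivative - (inverse r ^ 2) - \<mu>) (at r)"
      "((\<lambda>r. - (inverse r ^ 2) - \<mu>) has_real_derivative 2 * inverse r ^ 3) (at r)"
      unfolding profile_def[abs_def]
      by (auto intro!: derivative_eq_intros simp: power2_eq_square power3_eq_cube)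
  qed (use profile_pos in blast)
qed

lemma warp_profile_einstein:
  fixes g :: "'e::euclidean_space lmetric"
  assumes "local_metric S g"
    and ric: "\<And>x i j. x \<in> S \<Longrightarrow> i \<in> Basis \<Longrightarrow> j \<in> Basis \<Longrightarrow>
      ricci g x i j = 4 * \<mu> * (real DIM('e) - 1) * g x i j"
    and x: "x \<in> S" "r \<in> {0<..<collar \<mu>}" and ij: "i \<in> Basis" "j \<in> Basis"
  shows "ricci (warp (profile \<mu>) g) (x, r) i j + real DIM('e) * warp (profile \<mu>) g (x, r) i j = 0"
proof -
  interpret warped_metric S g "collar \<mu>" "profile \<mu>" "\<lambda>r. - (inverse r ^ 2) - \<mu>" "\<lambda>r. 2 * inverse r ^ 3"
    by (rule warped_metric_profile) fact
  have r: "r \<noteq> 0" "profile \<mu> r \<noteq> 0" using x profile_pos[OF x(2)] by auto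
  \<comment> \<open>With a prime for r d/dr and q the profile, the left side is (n - 1) (4 \<mu> -
    q'^2 + q^2) + q (q - q'').\<close>
  have tangential: "4 * \<mu> * (n - 1)
      - (n * (r * (- (inverse r ^ 2) - \<mu>))\<^sup>2 - (r * (- (inverse r ^ 2) - \<mu>))\<^sup>2
        + r * profile \<mu> r * (- (inverse r ^ 2) - \<mu>) + r\<^sup>2 * profile \<mu> r * (2 * inverse r ^ 3))
      + n * (profile \<mu> r)\<^sup>2 = 0" for n
    using r(1) by (simp add: profile_def field_simps power2_eq_square power3_eq_cube)
  \<comment> \<open>This is q'' = q, divided by r^2 q.\<close>
  have normal: "2 * inverse r ^ 3 / profile \<mu> r + (- (inverse r ^ 2) - \<mu>) / (r * profile \<mu> r) = 1 / r\<^sup>2"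
  proof -
    have "2 * inverse r ^ 3 * r + (- (inverse r ^ 2) - \<mu>) = profile \<mu> r / r"
      using r(1) by (simp add: profile_def field_simps power2_eq_square power3_eq_cube)
    then show ?thesis
      using r by (simp add: field_simps power2_eq_square)
  qed
  consider a b where "a \<in> Basis" "b \<in> Basis" "i = (a, 0)" "j = (b, 0)"
    | a where "a \<in> Basis" "i = (a, 0)" "j = (0, 1)"
    | b where "b \<in> Basis" "i = (0, 1)" "j = (b, 0)"
    | "i = (0, 1)" "j = (0, 1)"
    using ij by (auto simp: Basis_prod_def)
  then show ?thesis
  proof cases
    case 1
    then show ?thesis
      using arg_cong[OF tangential[of "real DIM('e)"], of "\<lambda>t. t * g x a b"]
      by (simp add: ricci_warp(1)[OF x] ric[OF x(1)] warp_def algebra_simps)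
  next
    case 2
    then show ?thesis
      by (simp add: ricci_warp(3)[OF x] warp_def pd_metric_0[OF x(1)])
  next
    case 3
    then show ?thesis
      by (simp add: ricci_warp(2)[OF x] warp_def pd_metric_0[OF x(1)])
  next
    case 4
    have "ricci (warp (profile \<mu>) g) (x, r) (0, 1) (0, 1) = - real DIM('e) * (1 / r\<^sup>2)"
      unfolding ricci_warp(4)[OF x SOME_Basis SOME_Basis] normal ..
    then show ?thesis
      using 4 by (simp add: warp_def pd_metric_0[OF x(1)])
  qed
qed

definition model_metric :: "real \<Rightarrow> ('m, 'e::euclidean_space) tensor2 \<Rightarrow> ('m \<times> real, 'e \<times> real) tensor2" where
  "model_metric \<mu> g C = warp (profile \<mu>) (g (uncyl C))"

lemma model_metric_cyl: "model_metric \<mu> g (cyl (collar \<mu>) c) = warp (profile \<mu>) (g c)"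
  by (simp add: model_metric_def uncyl_cyl collar_pos)

lemma warp_profile_eq: "r \<noteq> 0 \<Longrightarrow> warp (profile \<mu>) g (x, r) (a, s) (b, t) = (s * t + (1 - \<mu> * r\<^sup>2)\<^sup>2 * g x a b) / r\<^sup>2"
  by (simp add: warp_def profile_def field_simps power2_eq_square)

lemma warp_profile_smooth:
  assumes "open S" "smooth_on (\<lambda>x. g x (fst a) (fst b)) S"
  shows "smooth_on (\<lambda>z. warp (profile \<mu>) g z a b) (S \<times> {0<..<\<epsilon>})"
proof -
  let ?T = "S \<times> {0<..<\<epsilon>}"
  have op: "open ?T" using assms(1) by (intro open_Times) auto
  have inv: "smooth_on (\<lambda>z. inverse (snd z) ^ m) ?T" for m
    by (rule smooth_on_subset[OF smooth_on_inverse_snd_power]) auto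
  \<comment> \<open>The profile is rewritten with a first power of the inverse so that the
    smoothness of inverse powers applies.\<close>
  have prof: "smooth_on (\<lambda>z. inverse (snd z) ^ 1 + (- \<mu>) * snd z) ?T"
    by (intro smooth_on_add smooth_on_mult smooth_on_const smooth_on_snd inv op)
  have gs: "smooth_on (\<lambda>z::'a \<times> real. g (fst z) (fst a) (fst b)) ?T"
    by (rule smooth_on_subset[OF smooth_on_comp_fst[OF assms]]) auto
  have "smooth_on (\<lambda>z. (snd a * snd b) * inverse (snd z) ^ 2 +
     ((inverse (snd z) ^ 1 + (- \<mu>) * snd z) * (inverse (snd z) ^ 1 + (- \<mu>) * snd z)) * g (fst z) (fst a) (fst b)) ?T"
    by (intro smooth_on_add[OF op] smooth_on_mult[OF op] smooth_on_const inv prof gs)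
  then show ?thesis
    by (simp add: warp_def profile_def divide_inverse power2_eq_square power_inverse)
qed

lemma poincare_model_metric:
  fixes A :: "('m::{t2_space,second_countable_topology}, 'e::euclidean_space) chart set"
  assumes M: "smooth_manifold S A" and g: "riemannian_metric A g"
    and einst: "einstein_with A g (4 * \<mu> * (real DIM('e) - 1))"
    and "even DIM('e)"
  shows "poincare_metric A g (collar \<mu>) (model_metric \<mu> g)"
proof -
  let ?\<epsilon> = "collar \<mu>"
  have n: "DIM('e) \<ge> 2"
    using assms(4) DIM_positive[where 'a='e] by presburger
  have loc: "local_metric (crange c) (g c)" if "c \<in> A" for c
    using local_metric_chart[OF M g that] .
  have sym: "symmetric_tensor A g" using g by (simp add: riemannian_metric_def)
  \<comment> \<open>Every coefficient of the expansion is a constant multiple of g; the factor 0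
    provides the logarithmic one.\<close>
  have scaled: "symmetric_tensor A (\<lambda>c x a b. k * g c x a b)" for k :: real
    unfolding symmetric_tensor_def
  proof (intro conjI ballI allI)
    fix c x assume c: "c \<in> A" "x \<in> crange c"
    then have "bilinear (g c x)" using sym by (simp add: symmetric_tensor_def)
    then show "bilinear (\<lambda>a b. k * g c x a b)"
      by (auto simp: bilinear_def linear_iff algebra_simps)
    show "k * g c x a b = k * g c x b a" for a b
      using sym c by (simp add: symmetric_tensor_def)
  next
    fix c a b assume "c \<in> A"
    then show "smooth_on (\<lambda>x. k * g c x a b) (crange c)"
      using sym crange_open[OF M]
      by (intro smooth_on_mult smooth_on_const) (auto simp: symmetric_tensor_def)
  next
    fix c c' p a b assume "c \<in> A" "c' \<in> A" "p \<in> fst c \<inter> fst c'"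
    then have "g c (snd c p) a b = g c' (snd c' p) (frechet_derivative (snd c' \<circ> cinv c) (at (snd c p)) a)
                        (frechet_derivative (snd c' \<circ> cinv c) (at (snd c p)) b)"
      using sym unfolding symmetric_tensor_def by blast
    then show "k * g c (snd c p) a b = k * g c' (snd c' p) (frechet_derivative (snd c' \<circ> cinv c) (at (snd c p)) a)
                        (frechet_derivative (snd c' \<circ> cinv c) (at (snd c p)) b)"
      by simp
  qed
  have "riemannian_metric (cyl ?\<epsilon> ` A) (model_metric \<mu> g)"
    unfolding riemannian_metric_def symmetric_tensor_def
  proof (intro conjI ballI allI impI; (elim imageE)?)
    fix C z c assume C: "C = cyl ?\<epsilon> c" "c \<in> A" and "z \<in> crange C"
    then obtain x r where z: "z = (x, r)" "x \<in> crange c" "r \<in> {0<..<?\<epsilon>}"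
      by (auto simp: crange_cyl)
    interpret local_metric "crange c" "g c" by (rule loc) fact
    have bil: "bilinear (g c x)" using bilin[OF z(2)] .
    show "bilinear (model_metric \<mu> g C z)"
      unfolding C model_metric_cyl z(1)
      by (auto simp: bilinear_def linear_iff warp_def bilinear_ladd[OF bil] bilinear_radd[OF bil]
         bilinear_lmul[OF bil] bilinear_rmul[OF bil] algebra_simps add_divide_distrib)
    show "model_metric \<mu> g C z a b = model_metric \<mu> g C z b a" for a b
      unfolding C model_metric_cyl z(1) by (simp add: warp_def symm[OF z(2)] mult.commute)
    fix a :: "'e \<times> real" assume a: "a \<noteq> 0"
    have r: "0 < r" "0 < profile \<mu> r" using z(3) profile_pos by auto
    have "0 \<le> g c x (fst a) (fst a)"
      using pos[OF z(2), of "fst a"] bilinear_lzero[OF bil] by (cases "fst a = 0") auto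
    \<comment> \<open>A nonzero vector may lie in one factor only, so both summands are nonnegative
      and at least one is positive.\<close>
    moreover have "0 < snd a * snd a \<or> 0 < g c x (fst a) (fst a)"
      using pos[OF z(2), of "fst a"] a by (cases "fst a = 0") (auto simp: prod_eq_iff zero_less_mult_iff)
    ultimately show "0 < model_metric \<mu> g C z a a"
      unfolding C model_metric_cyl z(1) warp_def using r
      by (elim disjE) (simp_all add: add_pos_nonneg add_nonneg_pos)
  next
    fix C c a b assume C: "C = cyl ?\<epsilon> c" "c \<in> A"
    interpret local_metric "crange c" "g c" by (rule loc) fact
    show "smooth_on (\<lambda>x. model_metric \<mu> g C x a b) (crange C)"
      unfolding C model_metric_cyl crange_cyl by (intro warp_profile_smooth open_S smooth)
  next
    fix C C' P c c' and a b :: "'e \<times> real" assume C: "C = cyl ?\<epsilon> c" "c \<in> A" "C' = cyl ?\<epsilon> c'" "c' \<in> A"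
      and "P \<in> fst C \<inter> fst C'"
    then obtain p r where P: "P = (p, r)" "p \<in> fst c" "p \<in> fst c'" "r \<in> {0<..<?\<epsilon>}"
      by (auto simp: cyl_def)
    let ?D = "frechet_derivative (snd c' \<circ> cinv c) (at (snd c p))"
    have "g c (snd c p) (fst a) (fst b) = g c' (snd c' p) (?D (fst a)) (?D (fst b))"
      using sym C P unfolding symmetric_tensor_def by blast
    moreover have "snd (cyl ?\<epsilon> c) (p, r) = (snd c p, r)" for c :: "('m, 'e) chart"
      by (simp add: cyl_def)
    ultimately show "model_metric \<mu> g C (snd C P) a b = model_metric \<mu> g C' (snd C' P)
        (frechet_derivative (snd C' \<circ> cinv C) (at (snd C P)) a)
        (frechet_derivative (snd C' \<circ> cinv C) (at (snd C P)) b)"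
      unfolding C model_metric_cyl P(1)
      by (simp add: transition_cyl[OF M C(2,4) P(2-4)] warp_def)
  qed
  moreover
  \<comment> \<open>Read off from (1 - \<mu> r^2)^2 = 1 - 2 \<mu> r^2 + \<mu>^2 r^4, whose constant
    term is g itself.\<close>
  define coef where "coef = (\<lambda>k::nat. if k = 2 then - 2 * \<mu> else if k = 4 then \<mu>\<^sup>2 else 0)"
  define gk where "gk = (\<lambda>k. (\<lambda>c x a b. coef k * g c x a b) :: ('m, 'e) tensor2)"
  have remainder: "bdry_O_smooth (crange c) (\<lambda>r. r ^ (DIM('e) + 1))
      (\<lambda>(x, r). (1 - \<mu> * r\<^sup>2)\<^sup>2 * g c x a b
          - (g c x a b + (\<Sum>k | 2 \<le> k \<and> k \<le> DIM('e) \<and> even k. r ^ k * gk k c x a b)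
             + r ^ DIM('e) * ln r * 0))" (is "bdry_O_smooth _ _ ?F")
    if "c \<in> A" for c a b
    \<comment> \<open>In dimension 2 the term \<open>\<mu>\<^sup>2 r\<^sup>4 g\<close> is part of the remainder.\<close>
  proof (cases "DIM('e) = 2")
    case True
    interpret local_metric "crange c" "g c" by (rule loc) fact
    have "{k. 2 \<le> k \<and> k \<le> DIM('e) \<and> even k} = {2}"
      using True by auto
    then have "?F (x, r) = (\<mu>\<^sup>2 * g c x a b) * r ^ 4" for x r
      by (simp add: gk_def coef_def algebra_simps power2_eq_square eval_nat_numeral)
    moreover have "smooth_on (\<lambda>x. \<mu>\<^sup>2 * g c x a b) (crange c)"
      by (intro smooth_on_mult smooth_on_const open_S smooth)
    ultimately show ?thesis
      using True by (intro bdry_O_smooth_monomial[OF open_S collar_pos, where m = 4]) auto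
  next
    case False
    \<comment> \<open>An even dimension other than 2 is at least 4, so both coefficient indices lie
      in the summation range and the expansion is exact.\<close>
    then have "4 \<le> DIM('e)" using n assms(4) by presburger
    then have "(\<Sum>k | 2 \<le> k \<and> k \<le> DIM('e) \<and> even k. r ^ k * gk k c x a b)
        = (\<Sum>k\<in>{2, 4}. r ^ k * gk k c x a b)" for x r
      by (intro sum.mono_neutral_right) (auto simp: gk_def coef_def)
    then have "?F (x, r) = 0" for x r
      by (simp add: gk_def coef_def algebra_simps power2_eq_square eval_nat_numeral)
    then show ?thesis
      using crange_open[OF M that] by (intro bdry_O_smooth_zero[OF _ collar_pos]) auto
  qed
  have "symmetric_tensor A (gk k)" for k
    unfolding gk_def by (rule scaled)
  moreover have "bdry_O (crange c) (\<lambda>r. r ^ (DIM('e) - 1) * ln r)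
          (\<lambda>z. ricci (model_metric \<mu> g (cyl ?\<epsilon> c)) z i j + real DIM('e) * model_metric \<mu> g (cyl ?\<epsilon> c) z i j)"
    if "c \<in> A" "i \<in> Basis" "j \<in> Basis" for c i j
    unfolding model_metric_cyl
    by (intro bdry_O_zero[OF collar_pos] warp_profile_einstein loc)
      (use that einst in \<open>auto simp: einstein_with_def intro: loc\<close>)
  ultimately show ?thesis
    unfolding poincare_metric_def
    using collar_pos scaled[of 0] remainder
    by (intro conjI exI[of _ "\<lambda>r c x a b. (1 - \<mu> * r\<^sup>2)\<^sup>2 * g c x a b"] exI[of _ gk]
        exI[of _ "\<lambda>_ _ _ _. 0"]) (auto simp: model_metric_cyl warp_profile_eq)
qed

section \<open>The constant extension of a harmonic map\<close>

lemma is_exp_0: "is_exp B h q (\<lambda>_. 0) q"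
  unfolding is_exp_def
  \<comment> \<open>The constant curve is a geodesic because the Christoffel term is quadratic in
    the velocity.\<close>
  by (rule exI[of _ "\<lambda>_. q"], rule exI[of _ "\<lambda>_ _. 0"]) (simp add: christoffel_vec_def)

lemma approx_harmonic_extension_const:
  fixes A :: "('m::{t2_space,second_countable_topology}, 'e::euclidean_space) chart set"
    and B :: "('q::{t2_space,second_countable_topology}, 'f::euclidean_space) chart set"
  assumes M: "smooth_manifold UNIV A" and g: "riemannian_metric A g"
    and N: "smooth_manifold UNIV B" and harm: "harmonic_map A g B h \<phi>"
  shows "approx_harmonic_extension A B h \<phi> (collar \<mu>) (model_metric \<mu> g) (\<lambda>_ _. 0) (\<phi> \<circ> fst) (\<lambda>_ _. 0)"
proof -
  let ?\<epsilon> = "collar \<mu>" and ?\<psi> = "\<phi> \<circ> (fst :: 'm \<times> real \<Rightarrow> 'm)"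
  have sm: "smooth_map A B \<phi>" using harm by (simp add: harmonic_map_def)
  have cont: "continuous_on (fst c) \<phi>" if "c \<in> A" for c
    using sm that by (simp add: smooth_map_def)
  \<comment> \<open>Continuity is given chart by chart and glued over the open cover; continuity of
    the extension up to r = 0 needs it globally, since the cylinder charts exclude the
    boundary.\<close>
  have cont': "continuous_on UNIV \<phi>"
  proof -
    have "(\<Union>c\<in>A. fst c) = UNIV" using M by (simp add: smooth_manifold_def)
    then show ?thesis
      using continuous_on_open_UN[of A fst \<phi>] chart_open[OF M] cont by metis
  qed
  have op: "open (ldom c d \<phi>)" if "c \<in> A" "d \<in> B" for c d
    using ldom_open[OF M that(1) chart_open[OF N that(2)] cont[OF that(1)]] .
  have sub: "ldom c d \<phi> \<subseteq> crange c" for c d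
    by (auto simp: ldom_def crange_def)
  have rep: "smooth_on (lrep c d \<phi>) (ldom c d \<phi>)" if "c \<in> A" "d \<in> B" for c d
    using sm that by (simp add: smooth_map_def)
  have ldom_cyl: "ldom (cyl ?\<epsilon> c) d ?\<psi> = ldom c d \<phi> \<times> {0<..<?\<epsilon>}" for c d
    by (force simp: ldom_def cyl_def)
  have op_cyl: "open (ldom c d \<phi> \<times> {0<..<?\<epsilon>})" if "c \<in> A" "d \<in> B" for c d
    by (intro open_Times op that) auto
  have lrep_cyl: "lrep (cyl ?\<epsilon> c) d ?\<psi> z = lrep c d \<phi> (fst z)"
    if "c \<in> A" "z \<in> ldom c d \<phi> \<times> {0<..<?\<epsilon>}" for c d z
    using that sub[of c d] cinv_cyl[OF chart_inj[OF M that(1)], of "fst z" "snd z" ?\<epsilon>]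
    by (auto simp: lrep_def)
  have "smooth_map (cyl ?\<epsilon> ` A) B ?\<psi>"
    unfolding smooth_map_def
  proof (intro conjI ballI; elim imageE; hypsubst)
    fix c assume "c \<in> A"
    show "continuous_on (fst (cyl ?\<epsilon> c)) ?\<psi>"
      by (intro continuous_on_compose continuous_on_fst continuous_on_id continuous_on_subset[OF cont'] subset_UNIV)
  next
    fix c d assume c: "c \<in> A" "d \<in> B"
    have "smooth_on (\<lambda>z::'e \<times> real. lrep c d \<phi> (fst z)) (ldom c d \<phi> \<times> {0<..<?\<epsilon>})"
      by (rule smooth_on_subset[OF smooth_on_comp_fst[OF op rep]]) (use c in auto)
    then show "smooth_on (lrep (cyl ?\<epsilon> c) d ?\<psi>) (ldom (cyl ?\<epsilon> c) d ?\<psi>)"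
      unfolding ldom_cyl by (subst smooth_on_cong[OF op_cyl[OF c] lrep_cyl[OF c(1)]])
  qed
  moreover have "continuous_on (UNIV \<times> {0..<?\<epsilon>}) ?\<psi>"
    by (intro continuous_on_compose continuous_on_fst continuous_on_id continuous_on_subset[OF cont'] subset_UNIV)
  moreover have "bdry_O (ldom c d \<phi>) b (codiff_tangent (model_metric \<mu> g) h (cyl ?\<epsilon> c) d ?\<psi>)"
    if c: "c \<in> A" "d \<in> B" for c d b
  proof (rule bdry_O_zero[OF collar_pos])
    fix x r assume x: "x \<in> ldom c d \<phi>" "r \<in> {0<..<?\<epsilon>}"
    interpret warped_metric "crange c" "g c" ?\<epsilon> "profile \<mu>" "\<lambda>r. - (inverse r ^ 2) - \<mu>" "\<lambda>r. 2 * inverse r ^ 3"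
      by (intro warped_metric_profile local_metric_chart[OF M g c(1)])
    have "codiff_tangent (model_metric \<mu> g) h (cyl ?\<epsilon> c) d ?\<psi> (x, r)
      = codiff (warp (profile \<mu>) (g c)) (h d) (\<lambda>z. lrep c d \<phi> (fst z)) (pd (\<lambda>z. lrep c d \<phi> (fst z))) (x, r)"
      unfolding codiff_tangent_def model_metric_cyl
      by (rule codiff_cong[OF op_cyl[OF c] _ lrep_cyl[OF c(1)]]) (use x in auto)
    also have "\<dots> = codiff_tangent g h c d \<phi> x /\<^sub>R (profile \<mu> r)\<^sup>2"
      unfolding codiff_tangent_def
      by (rule codiff_warp[OF _ x(2) op[OF c] x(1) rep[OF c]]) (use x sub[of c d] in auto)
    also have "\<dots> = 0"
      using harm c x by (simp add: harmonic_map_def)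
    finally show "codiff_tangent (model_metric \<mu> g) h (cyl ?\<epsilon> c) d ?\<psi> (x, r) = 0" .
  qed
  moreover have "bdry_O_smooth (ldom c d \<phi>) b (\<lambda>z. 0 :: 'f)"
    if c: "c \<in> A" "d \<in> B" for c d b
    by (rule bdry_O_smooth_zero[OF op[OF c] collar_pos]) simp
  ultimately show ?thesis
    unfolding approx_harmonic_extension_def
    using section_along_0[OF N, of A \<phi>] section_along_0[OF N, of "cyl ?\<epsilon> ` A" ?\<psi>] is_exp_0
    by (auto intro!: exI[of _ "\<lambda>_ _ _. 0"] simp: case_prod_unfold)
qed

theorem proposition3p7:
  fixes A :: "('m::{t2_space,second_countable_topology}, 'e::euclidean_space) chart set"
    and B :: "('q::{t2_space,second_countable_topology}, 'f::euclidean_space) chart set"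
    and g :: "('m, 'e) tensor2" and h :: "('q, 'f) tensor2"
    and \<phi> :: "'m \<Rightarrow> 'q"
  assumes "smooth_manifold (UNIV :: 'm set) A" and "compact (UNIV :: 'm set)"
    and "riemannian_metric A g" and "einstein A g"
    and "even DIM('e)"
    and "smooth_manifold (UNIV :: 'q set) B" and "compact (UNIV :: 'q set)"
    and "riemannian_metric B h"
    and "harmonic_map A g B h \<phi>"
  shows "C_harmonic_map A g B h \<phi>"
proof -
  obtain \<kappa> where \<kappa>: "einstein_with A g \<kappa>"
    using assms(4) by (auto simp: einstein_def)
  \<comment> \<open>This solves \<kappa> = 4 \<mu> (n - 1). Evenness of n rules out n = 1, where the
    division would fail.\<close>
  define \<mu> where "\<mu> = \<kappa> / (4 * (real DIM('e) - 1))"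
  have "DIM('e) \<ge> 2"
    using assms(5) DIM_positive[where 'a='e] by presburger
  then have "\<kappa> = 4 * \<mu> * (real DIM('e) - 1)"
    by (simp add: \<mu>_def nonzero_eq_divide_eq)
  then have "poincare_metric A g (collar \<mu>) (model_metric \<mu> g)"
    using poincare_model_metric[OF assms(1,3) _ assms(5)] \<kappa> by simp
  then have "is_log_coefficient A g B h \<phi> (\<lambda>_ _. 0)"
    unfolding is_log_coefficient_def
    using approx_harmonic_extension_const[OF assms(1,3,6,9)] by blast
  moreover have "smooth_map A B \<phi>"
    using assms(9) by (simp add: harmonic_map_def)
  ultimately show ?thesis
    by (auto simp: C_harmonic_map_def)
qed

end
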